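(* Let $\mu_{\theta,\theta-1}$ be a random measure with law $\mathcal{BG}(d\mu|\theta H,\theta-1)$. Then for $g$ a real-valued measurable function on $\mathcal Y$ whose absolute value satisfies $\int_{\mathcal Y}\log[1+|g(y)|]\,\theta H(dy)<\infty$, the following distributional equalities hold: (i) for all $\theta>0$, $$\mathcal L(\mu_{\theta,\theta-1}(g))=\mathcal L\big(U_{1,\theta}\,\mu_\theta(g)+U_{1,\theta}T_1g(Y_1)\big);$$ (ii) for $\theta>1$, $$\mathcal L(U_{1,\theta-1}\,\mu_\theta(g))=\mathcal L\big(U_{1,\theta}\,\mu_\theta(g)+U_{1,\theta}T_1g(Y_1)\big);$$ (iii) for $\theta=1$, $\mu_{1,0}:=\mu_1$ is a gamma process with shape $H$ and $$\mathcal L(\mu_1(g))=\mathcal L\big(U_{1,1}\,\mu_1(g)+U_{1,1}T_1g(Y_1)\big);$$ (iv) if $\mu_\theta$ denotes a gamma process with arbitrary shape parameter $\theta H$, $\theta>0$, then $$\mathcal L(\mu_\theta(g))=\mathcal L\big(U_{\theta,1}\,\mu_\theta(g)+U_{\theta,1}T_1g(Y_1)\big).$$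
   Context: $\mathcal Y$ is a Polish space, $\mathcal M$ is the space of boundedly finite measures on $\mathcal Y$, and $H$ is a fixed non-atomic probability measure on $\mathcal Y$. Write $\mu(g)=\int_{\mathcal Y}g(y)\mu(dy)$, $T=\mu(\mathcal Y)$, and $\mathcal L(Z)$ for the law of $Z$. $\mathcal G(d\mu|\theta H)$ is the law on $\mathcal M$ of the gamma process with shape $\theta H$, i.e. the random measure $\mu$ with independent values on disjoint sets and $\mu(A)$ gamma distributed with shape $\theta H(A)$ and scale $1$. For $\theta>0$, $$\mathcal{BG}(d\mu|\theta H,\theta-1)=\Gamma(\theta)\,T^{-(\theta-1)}\mathcal G(d\mu|\theta H),$$ a probability law on $\mathcal M$. Throughout: $\mu_\theta$ denotes a gamma process with shape $\theta H$; $U_{a,b}$ a beta random variable with parameters $(a,b)$ (density proportional to $u^{a-1}(1-u)^{b-1}$ on $(0,1)$); $T_p$ a gamma random variable with shape $p$ and scale $1$; $Y_1$ a random element of $\mathcal Y$ with distribution $H$; and the variables $\mu_\theta$, $U_{a,b}$, $T_p$, $Y_1$ are independent. Within each expression, repeated occurrences of $U_{a,b}$ refer to the same random variable. *)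

theory Defs
  imports "HOL-Probability.Probability"
begin

text \<open>
  A measure on a measurable space is non-atomic if every set of positive mass contains a
  measurable subset of strictly smaller positive mass.
\<close>

definition nonatomic :: "'a measure \<Rightarrow> bool" where
  "nonatomic M \<longleftrightarrow> (\<forall>A\<in>sets M. 0 < emeasure M A \<longrightarrow>
     (\<exists>B\<in>sets M. B \<subseteq> A \<and> 0 < emeasure M B \<and> emeasure M B < emeasure M A))"

definition boundedly_finite :: "'a::polish_space measure \<Rightarrow> bool" where
  "boundedly_finite m \<longleftrightarrow> sets m = sets borel \<and>
     (\<forall>A\<in>sets borel. bounded A \<longrightarrow> emeasure m A < \<infinity>)"

text \<open>
  The measurable space of boundedly finite measures, with the sigma-algebra generated by the
  evaluations at Borel sets. It coincides with the Borel sigma-algebra of the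
  weak-hash topology; the construction mirrors that of \<^const>\<open>subprob_algebra\<close>.
\<close>

definition bf_measures :: "'a::polish_space measure measure" where
  "bf_measures =
     (SUP A\<in>sets borel. vimage_algebra {m. boundedly_finite m} (\<lambda>m. emeasure m A) borel)"

lemma space_bf_measures: "space bf_measures = {m. boundedly_finite m}"
  by (auto simp: bf_measures_def space_Sup_eq_UN)

lemma measurable_emeasure_bf_measures [measurable]:
  "A \<in> sets borel \<Longrightarrow> (\<lambda>m. emeasure m A) \<in> borel_measurable bf_measures"
  by (auto intro!: measurable_Sup1 measurable_vimage_algebra1 simp: bf_measures_def)

definition gamma_density :: "real \<Rightarrow> real \<Rightarrow> real" where
  "gamma_density p x = (if 0 < x then x powr (p - 1) * exp (- x) / Gamma p else 0)"

definition beta_density :: "real \<Rightarrow> real \<Rightarrow> real \<Rightarrow> real" where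
  "beta_density a b x =
     (if 0 < x \<and> x < 1 then x powr (a - 1) * (1 - x) powr (b - 1) / Beta a b else 0)"

text \<open>The gamma distribution with shape 0 is the point mass at 0.\<close>

definition gamma_distribution :: "real \<Rightarrow> real measure" where
  "gamma_distribution p =
     (if p = 0 then return borel 0 else density lborel (\<lambda>x. ennreal (gamma_density p x)))"

text \<open>
  A gamma process on the probability space \<open>P\<close> whose shape is the finite Borel measure \<open>\<alpha>\<close>.
  The masses are compared as \<^typ>\<open>ennreal\<close>-valued variables, so that the mass of every Borel
  set is almost surely finite.
\<close>

definition gamma_process ::
  "'w measure \<Rightarrow> 'a::polish_space measure \<Rightarrow> ('w \<Rightarrow> 'a measure) \<Rightarrow> bool" where
  "gamma_process P \<alpha> \<mu> \<longleftrightarrow>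
     prob_space P \<and> \<mu> \<in> measurable P bf_measures \<and>
     (\<forall>A\<in>sets borel. distr P borel (\<lambda>w. emeasure (\<mu> w) A) =
        distr (gamma_distribution (measure \<alpha> A)) borel ennreal) \<and>
     (\<forall>(n::nat) A. (\<forall>i<n. A i \<in> sets borel) \<longrightarrow> disjoint_family_on A {..<n} \<longrightarrow>
        prob_space.indep_vars P (\<lambda>_. borel) (\<lambda>i w. emeasure (\<mu> w) (A i)) {..<n})"

definition gamma_process_law :: "'a::polish_space measure \<Rightarrow> 'a measure measure \<Rightarrow> bool" where
  "gamma_process_law \<alpha> G \<longleftrightarrow> sets G = sets bf_measures \<and> gamma_process G \<alpha> (\<lambda>m. m)"

text \<open>
  \<open>beta_gamma_law \<theta> H L\<close> says that \<open>L\<close> is the beta-gamma law with parameters \<open>\<theta> H\<close> and \<open>\<theta> - 1\<close>.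
  The junk values of the density at measures of total mass 0 or infinity do not matter, since
  the gamma process law gives such measures probability 0.
\<close>

definition beta_gamma_law ::
  "real \<Rightarrow> 'a::polish_space measure \<Rightarrow> 'a measure measure \<Rightarrow> bool" where
  "beta_gamma_law \<theta> H L \<longleftrightarrow>
     (\<exists>G. gamma_process_law (scale_measure (ennreal \<theta>) H) G \<and>
        L = density G (\<lambda>m. ennreal (Gamma \<theta> * measure m (space m) powr (- (\<theta> - 1)))))"

text \<open>
  \<^const>\<open>prob_space.indep_vars\<close> needs variables with a common value type. For variables of different
  types we use the events they generate, as its definition does, and state
  independence as \<open>indep_events_of P [events_of P M X, events_of P N Y, \<dots>]\<close>.
\<close>

definition events_of :: "'w measure \<Rightarrow> 'b measure \<Rightarrow> ('w \<Rightarrow> 'b) \<Rightarrow> 'w set set" where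
  "events_of P N X = {X -` A \<inter> space P | A. A \<in> sets N}"

definition indep_events_of :: "'w measure \<Rightarrow> 'w set set list \<Rightarrow> bool" where
  "indep_events_of P Es \<longleftrightarrow> prob_space.indep_sets P (\<lambda>i. Es ! i) {..<length Es}"

end

theory Submission
  imports Defs "HOL-Real_Asymp.Real_Asymp"
begin

text \<open>
  All four laws are compared through their characteristic functions, and these are governed by one
  ordinary differential equation. Write \<open>X = \<mu>(g)\<close>, let \<open>M\<close> be the total mass of \<open>\<mu>\<close>, and put
  \<open>\<alpha> = \<theta> H\<close>. Independence on disjoint sets and the Laplace transform of the gamma distribution at
  complex arguments give, by approximation with simple functions, the joint transform

    \<open>E exp (- c M + i t X) = exp (- \<integral> Ln (1 + c - i t g) d\<alpha>)\<close>   for \<open>c \<ge> 0\<close>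

  (lemma \<open>gamma_process_functional\<close>). The logarithmic moment of \<open>g\<close> enters twice: it makes the
  right-hand side finite, and it makes \<open>g\<close> almost surely \<open>\<mu>\<close>-integrable
  (lemma \<open>gamma_process_AE_integrable\<close>), so that the default value 0 of the integral of a
  non-integrable function occurs with probability 0 only.

  Fix \<open>s\<close>, and put \<open>\<Lambda>(u) = E exp (i s u X)\<close> and \<open>\<Psi>(u) = \<integral> 1 / (1 - i s u g) dH\<close>. The latter is
  the characteristic function of \<open>T\<^sub>1 g(Y\<^sub>1)\<close> at \<open>s u\<close>, so \<open>U X + U T\<^sub>1 g(Y\<^sub>1)\<close> has the characteristic
  function \<open>E[\<Lambda>(U) \<Psi>(U)]\<close> at \<open>s\<close>. Differentiating the exponent of the joint transform under the integral sign
  gives \<open>u \<Lambda>'(u) = \<theta> \<Lambda>(u) (\<Psi>(u) - 1)\<close>, that is,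

    \<open>d/du [u powr \<theta> \<Lambda>(u)] = \<theta> u powr (\<theta> - 1) \<Lambda>(u) \<Psi>(u)\<close>.

  Integrated over the unit interval, this says that \<open>\<Lambda>(1)\<close> is the mean of \<open>\<Lambda> \<Psi>\<close> under the beta
  distribution with parameters \<open>(\<theta>, 1)\<close>: the fixed point equation of the gamma process. For \<open>\<theta> > 1\<close>,
  the derivative of \<open>u (1 - u) powr (\<theta> - 1) \<Lambda>(u)\<close> is the integrand of the mean of \<open>\<Lambda> \<Psi>\<close> under beta
  \<open>(1, \<theta>)\<close> minus that of the mean of \<open>\<Lambda>\<close> under beta \<open>(1, \<theta> - 1)\<close>, and this function vanishes at
  both end points; so the two means agree.

  For the beta-gamma law, the density \<open>\<Gamma>(\<theta>) M powr (1 - \<theta>)\<close> is written as a mixture over \<open>u\<close> in the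
  unit interval of the functions \<open>M exp (- M (1 - u) / u)\<close> (lemma \<open>mass_kernel_integral\<close>). By the
  joint transform with \<open>1 + c = 1 / u\<close>, the factor \<open>exp (- M (1 - u) / u)\<close> turns \<open>E exp (i s X)\<close>
  into \<open>u powr \<theta> \<Lambda>(u)\<close>. The further factor \<open>M\<close> amounts to a derivative in \<open>u\<close>, which the
  differential equation evaluates, and the mixture becomes the mean of \<open>\<Lambda> \<Psi>\<close> under beta \<open>(1, \<theta>)\<close>.
  For \<open>\<theta> = 1\<close> the density is almost surely 1, and the beta-gamma law is the law of the gamma process.
\<close>

section \<open>Differentiation under the integral sign\<close>

text \<open>
  The bound on \<open>f'\<close> makes \<open>f\<close> Lipschitz in the parameter with an integrable constant, so dominated
  convergence applies to the difference quotients. It is used three times: for the gamma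
  transform, for the logarithmic exponent and for the exponentially tilted expectations.
\<close>

lemma has_vector_derivative_integral_dominated:
  fixes f f' :: "real \<Rightarrow> 'w \<Rightarrow> 'b::{banach, second_countable_topology}"
  assumes x: "a < x" "x < b"
    and int: "\<And>t. a < t \<Longrightarrow> t < b \<Longrightarrow> integrable M (f t)"
    and meas: "f' x \<in> borel_measurable M"
    and deriv: "\<And>t w. a < t \<Longrightarrow> t < b \<Longrightarrow> w \<in> space M \<Longrightarrow>
        ((\<lambda>t. f t w) has_vector_derivative f' t w) (at t)"
    and bound: "\<And>t w. a < t \<Longrightarrow> t < b \<Longrightarrow> w \<in> space M \<Longrightarrow> norm (f' t w) \<le> B w"
    and B: "integrable M B"
  shows "((\<lambda>t. \<integral>w. f t w \<partial>M) has_vector_derivative (\<integral>w. f' x w \<partial>M)) (at x)"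
proof -
  have int': "integrable M (f' x)"
    using B meas by (rule Bochner_Integration.integrable_bound) (use bound[OF x] in \<open>auto intro!: AE_I2 order_trans[OF bound[OF x]]\<close>)
  have lip: "norm (f t w - f x w) \<le> B w * \<bar>t - x\<bar>" if t: "a < t" "t < b" and w: "w \<in> space M" for t w
  proof -
    have "norm (f t w - f x w) \<le> B w * norm (t - x)"
    proof (rule differentiable_bound[of "{a<..<b}"])
      show "((\<lambda>t. f t w) has_derivative (\<lambda>h. h *\<^sub>R f' y w)) (at y within {a<..<b})" if "y \<in> {a<..<b}" for y
        using deriv[of y w] that w by (auto simp: has_vector_derivative_def intro: has_derivative_at_withinI)
      show "onorm (\<lambda>h::real. h *\<^sub>R f' y w) \<le> B w" if "y \<in> {a<..<b}" for y
        using bound[of y w] that w by (intro onorm_le) (auto simp: mult.commute[of "\<bar>_\<bar>"] intro!: mult_right_mono)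
    qed (use t x in auto)
    then show ?thesis by simp
  qed
  \<comment> \<open>the remainder of the linear approximation, relative to the increment\<close>
  define h where "h y w = (f y w - f x w - (y - x) *\<^sub>R f' x w) /\<^sub>R norm (y - x)" for y w
  have lim: "((\<lambda>y. \<integral>w. h y w \<partial>M) \<longlongrightarrow> 0) (at x)"
  proof (subst tendsto_at_iff_sequentially, intro allI impI)
    fix X :: "nat \<Rightarrow> real" assume X: "\<forall>i. X i \<in> UNIV - {x}" "X \<longlonglongrightarrow> x"
    then have "\<forall>\<^sub>F n in sequentially. a < X n \<and> X n < b"
      using x by (intro eventually_conj order_tendstoD) auto
    then obtain N where N: "\<And>n. n \<ge> N \<Longrightarrow> a < X n \<and> X n < b" by (auto simp: eventually_sequentially)
    have "(\<lambda>n. \<integral>w. h (X (n + N)) w \<partial>M) \<longlonglongrightarrow> (\<integral>w. 0 \<partial>M)"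
    proof (rule integral_dominated_convergence[where w="\<lambda>w. 2 * B w"])
      show "integrable M (\<lambda>w. 2 * B w)" using B by simp
      show "h (X (n + N)) \<in> borel_measurable M" for n
        unfolding h_def using N[of "n + N"] int int' x by (intro borel_measurable_scaleR borel_measurable_diff) auto
      show "AE w in M. (\<lambda>n. h (X (n + N)) w) \<longlonglongrightarrow> 0"
      proof (rule AE_I2)
        fix w assume "w \<in> space M"
        then have "((\<lambda>y. h y w) \<longlongrightarrow> 0) (at x)"
          using deriv[of x w] x unfolding has_vector_derivative_def has_derivative_at_within h_def by simp
        then have "((\<lambda>y. h y w) \<circ> X) \<longlonglongrightarrow> 0" using X unfolding tendsto_at_iff_sequentially by blast
        then show "(\<lambda>n. h (X (n + N)) w) \<longlonglongrightarrow> 0"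
          unfolding comp_def by (rule LIMSEQ_ignore_initial_segment)
      qed
      show "AE w in M. norm (h (X (n + N)) w) \<le> 2 * B w" for n
      proof (rule AE_I2)
        fix w assume w: "w \<in> space M"
        let ?y = "X (n + N)"
        have y: "a < ?y" "?y < b" "?y \<noteq> x" using N[of "n + N"] X by auto
        have "norm (f ?y w - f x w - (?y - x) *\<^sub>R f' x w) \<le> B w * \<bar>?y - x\<bar> + \<bar>?y - x\<bar> * B w"
          using norm_triangle_ineq4[of "f ?y w - f x w" "(?y - x) *\<^sub>R f' x w"] lip[OF y(1,2) w]
            mult_left_mono[OF bound[OF x w], of "\<bar>?y - x\<bar>"] by (simp only: norm_scaleR real_norm_def) linarith
        also have "\<dots> = (2 * B w) * \<bar>?y - x\<bar>" by simp
        finally have "norm (f ?y w - f x w - (?y - x) *\<^sub>R f' x w) / \<bar>?y - x\<bar> \<le> 2 * B w"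
          using y by (simp add: pos_divide_le_eq)
        moreover have "norm (h ?y w) = norm (f ?y w - f x w - (?y - x) *\<^sub>R f' x w) / \<bar>?y - x\<bar>"
          by (simp only: h_def norm_scaleR divide_inverse norm_inverse real_norm_def abs_abs abs_inverse mult.commute)
        ultimately show "norm (h ?y w) \<le> 2 * B w" by simp
      qed
    qed simp
    then show "((\<lambda>y. \<integral>w. h y w \<partial>M) \<circ> X) \<longlonglongrightarrow> 0"
      unfolding comp_def Bochner_Integration.integral_zero by (rule LIMSEQ_offset)
  qed
  have "((\<lambda>y. ((\<integral>w. f y w \<partial>M) - (\<integral>w. f x w \<partial>M) - (y - x) *\<^sub>R (\<integral>w. f' x w \<partial>M)) /\<^sub>R norm (y - x)) \<longlongrightarrow> 0) (at x)"
  proof (rule Lim_transform_eventually[OF lim])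
    have "\<forall>\<^sub>F y in at x. a < y \<and> y < b"
      using x by (intro eventually_conj order_tendstoD[OF tendsto_ident_at]) auto
    then show "\<forall>\<^sub>F y in at x. (\<integral>w. h y w \<partial>M) =
        ((\<integral>w. f y w \<partial>M) - (\<integral>w. f x w \<partial>M) - (y - x) *\<^sub>R (\<integral>w. f' x w \<partial>M)) /\<^sub>R norm (y - x)"
    proof eventually_elim
      case (elim y)
      then show ?case unfolding h_def using int[of y] int[of x] int' x
        by simp
    qed
  qed
  then show ?thesis
    unfolding has_vector_derivative_def has_derivative_at_within by (simp add: bounded_linear_scaleR_left)
qed

section \<open>The Laplace transform of the gamma distribution\<close>

lemma gamma_density_nonneg: "0 < p \<Longrightarrow> 0 \<le> gamma_density p x"
  by (simp add: gamma_density_def)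

lemma measurable_gamma_density [measurable]: "gamma_density p \<in> borel_measurable borel"
  unfolding gamma_density_def by measurable

lemma nn_integral_gamma_density:
  assumes "0 < p"
  shows "(\<integral>\<^sup>+x. ennreal (gamma_density p x) \<partial>lborel) = 1"
proof -
  have G: "Gamma p > 0" using assms by simp
  have "(\<integral>\<^sup>+x. ennreal (gamma_density p x) \<partial>lborel) =
      (\<integral>\<^sup>+x. ennreal (1 / Gamma p) * ennreal (indicator {0..} x * x powr (p - 1) / exp x) \<partial>lborel)"
  proof (rule nn_integral_cong)
    fix x :: real
    have "gamma_density p x = 1 / Gamma p * (indicator {0..} x * x powr (p - 1) / exp x)"
      by (cases "0 < x") (auto simp: gamma_density_def exp_minus divide_inverse)
    then show "ennreal (gamma_density p x) = ennreal (1 / Gamma p) * ennreal (indicator {0..} x * x powr (p - 1) / exp x)"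
      using G by (subst ennreal_mult[symmetric]) auto
  qed
  also have "\<dots> = ennreal (1 / Gamma p) * ennreal (Gamma p)"
    by (subst nn_integral_cmult) (auto simp: Gamma_conv_nn_integral_real[OF assms])
  also have "\<dots> = 1" using G by (simp add: ennreal_mult[symmetric])
  finally show ?thesis .
qed

lemma integrable_gamma_density:
  assumes "0 < p" shows "integrable lborel (gamma_density p)"
  using assms by (intro integrableI_nonneg) (auto simp: gamma_density_nonneg nn_integral_gamma_density)

lemma integral_gamma_density:
  assumes "0 < p" shows "(\<integral>x. gamma_density p x \<partial>lborel) = 1"
  using assms by (subst integral_eq_nn_integral) (auto simp: gamma_density_nonneg nn_integral_gamma_density)

text \<open>
  Multiplication by \<open>x\<close> raises the shape by 1; differentiating the Laplace transform therefore relates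
  the transforms of neighbouring shapes.
\<close>

lemma mult_gamma_density:
  assumes "0 < p" shows "x * gamma_density p x = p * gamma_density (p + 1) x"
proof (cases "0 < x")
  case True
  have "x * x powr (p - 1) = x powr p" using True by (simp add: powr_mult_base)
  moreover have "Gamma (p + 1) = p * Gamma p"
    using assms by (intro Gamma_plus1) (auto elim!: nonpos_Ints_cases)
  ultimately show ?thesis using True assms
    by (simp add: gamma_density_def)
qed (auto simp: gamma_density_def)

lemma cmod_exp_gamma_le_1:
  assumes "0 \<le> Re v" "0 \<le> x" shows "cmod (exp (- (v * of_real x))) \<le> 1"
  using assms by simp

lemma norm_gamma_exp_le:
  assumes "0 < p" "0 \<le> Re v"
  shows "norm (of_real (gamma_density p x) * exp (- (v * of_real x))) \<le> gamma_density p x"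
proof (cases "0 < x")
  case True
  have "norm (of_real (gamma_density p x) * exp (- (v * of_real x))) = gamma_density p x * cmod (exp (- (v * of_real x)))"
    using gamma_density_nonneg[OF assms(1), of x] by (simp add: norm_mult)
  also have "\<dots> \<le> gamma_density p x"
    using True assms gamma_density_nonneg[OF assms(1), of x] cmod_exp_gamma_le_1[of v x] by (intro mult_left_le) auto
  finally show ?thesis .
qed (simp add: gamma_density_def)

lemma integrable_gamma_exp:
  assumes "0 < p" "0 \<le> Re v"
  shows "complex_integrable lborel (\<lambda>x. of_real (gamma_density p x) * exp (- (v * of_real x)))"
  by (rule Bochner_Integration.integrable_bound[OF integrable_gamma_density[OF assms(1)]])
     (use norm_gamma_exp_le[OF assms] in \<open>auto intro!: AE_I2 order_trans[OF norm_gamma_exp_le[OF assms]]\<close>)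

text \<open>
  Integration by parts with the primitive \<open>x powr p exp (- (1 + v) x) / \<Gamma>(p + 1)\<close>, whose boundary
  values at 0 and at infinity vanish.
\<close>

lemma gamma_exp_parts:
  fixes v :: complex
  assumes p: "0 < p" and v: "0 \<le> Re v"
  shows "(1 + v) * (\<integral>x. of_real (gamma_density (p + 1) x) * exp (- (v * of_real x)) \<partial>lborel) =
    (\<integral>x. of_real (gamma_density p x) * exp (- (v * of_real x)) \<partial>lborel)"
proof -
  let ?I = "\<lambda>p x. of_real (gamma_density p x) * exp (- (v * of_real x)) :: complex"
  define D where "D x = ?I p x - (1 + v) * ?I (p + 1) x" for x
  define F :: "real \<Rightarrow> complex" where "F x = of_real (x powr p / Gamma (p + 1)) * exp (- ((1 + v) * of_real x))" for x
  have GG: "Gamma (p + 1) = p * Gamma p" "Gamma (p + 1) \<noteq> 0"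
    using p Gamma_real_pos[of "p + 1"] by (auto intro!: Gamma_plus1 simp del: Gamma_real_pos elim!: nonpos_Ints_cases)
  have D: "complex_integrable lborel D"
    unfolding D_def using assms by (intro Bochner_Integration.integrable_diff integrable_mult_right integrable_gamma_exp) auto
  have F: "(F has_vector_derivative D x) (at x)" if "0 < x" for x
  proof -
    have "((\<lambda>x. x powr p / Gamma (p + 1)) has_real_derivative p * x powr (p - 1) / Gamma (p + 1)) (at x)"
      using that p GG by (auto intro!: derivative_eq_intros)
    then have "(F has_vector_derivative of_real (p * x powr (p - 1) / Gamma (p + 1)) * exp (- ((1 + v) * of_real x))
        + of_real (x powr p / Gamma (p + 1)) * (- (1 + v) * exp (- ((1 + v) * of_real x)))) (at x)"
      unfolding F_def
      by (intro has_vector_derivative_eq_rhs[OF has_vector_derivative_mult]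
          has_vector_derivative_of_real has_vector_derivative_real_field[where f="\<lambda>z. exp (- ((1 + v) * z))"])
         (use that in \<open>auto intro!: derivative_eq_intros simp: has_real_derivative_iff_has_vector_derivative\<close>)
    moreover have "of_real (p * x powr (p - 1) / Gamma (p + 1)) * exp (- ((1 + v) * of_real x)) = ?I p x"
      using that p GG by (simp add: gamma_density_def ring_distribs exp_add exp_diff exp_minus exp_of_real[symmetric] field_simps)
    moreover have "of_real (x powr p / Gamma (p + 1)) * (- (1 + v) * exp (- ((1 + v) * of_real x))) = - (1 + v) * ?I (p + 1) x"
      using that p by (simp add: gamma_density_def ring_distribs exp_add exp_diff exp_minus exp_of_real[symmetric] field_simps)
    ultimately show ?thesis by (simp only: D_def diff_conv_add_uminus mult_minus_left)
  qed
  have nF: "norm (F x) = x powr p / Gamma (p + 1) * exp (- (1 + Re v) * x)" if "0 < x" for x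
    unfolding F_def norm_mult norm_of_real norm_exp_eq_Re using p that Gamma_real_pos[of "p + 1"] by (simp add: algebra_simps)
  have lim0: "((F \<circ> real_of_ereal) \<longlongrightarrow> 0) (at_right 0)"
  proof -
    have "((\<lambda>x. x powr p) \<longlongrightarrow> 0) (at_right 0)"
      using p by real_asymp
    then have "((\<lambda>x. x powr p / Gamma (p + 1) * exp (- (1 + Re v) * x)) \<longlongrightarrow> 0 / Gamma (p + 1) * exp (- (1 + Re v) * 0)) (at_right 0)"
      using GG by (intro tendsto_intros) auto
    then have "((\<lambda>x. x powr p / Gamma (p + 1) * exp (- (1 + Re v) * x)) \<longlongrightarrow> 0) (at_right 0)" by simp
    moreover have "\<forall>\<^sub>F x in at_right 0. x powr p / Gamma (p + 1) * exp (- (1 + Re v) * x) = norm (F x)"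
      using nF by (auto simp: eventually_at_filter)
    ultimately have "((\<lambda>x. norm (F x)) \<longlongrightarrow> 0) (at_right 0)"
      by (rule Lim_transform_eventually)
    then have "(F \<longlongrightarrow> 0) (at_right 0)" by (rule tendsto_norm_zero_cancel)
    then show ?thesis by (simp only: zero_ereal_def ereal_tendsto_simps)
  qed
  have liminf: "((F \<circ> real_of_ereal) \<longlongrightarrow> 0) (at_left \<infinity>)"
  proof -
    have "((\<lambda>x. x powr p * exp (- x)) \<longlongrightarrow> 0) at_top"
      using p by real_asymp
    from tendsto_divide[OF this tendsto_const GG(2)]
    have "((\<lambda>x. x powr p / Gamma (p + 1) * exp (- x)) \<longlongrightarrow> 0) at_top" by simp
    moreover have "\<forall>\<^sub>F x in at_top. norm (F x) \<le> x powr p / Gamma (p + 1) * exp (- x)"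
      using eventually_gt_at_top[of 0]
    proof eventually_elim
      case (elim x)
      have "- (1 + Re v) * x \<le> - x" using v elim by (simp add: ring_distribs)
      then show ?case unfolding nF[OF elim] using p by (intro mult_left_mono) auto
    qed
    ultimately have "(F \<longlongrightarrow> 0) at_top" by (rule Lim_null_comparison[rotated])
    then show ?thesis by (simp add: ereal_tendsto_simps)
  qed
  have "(LBINT x=0..\<infinity>. D x) = 0 - 0"
  proof (rule interval_integral_FTC_integrable[of 0 \<infinity> F])
    show "(F has_vector_derivative D x) (at x)" if "(0::ereal) < ereal x" for x
      using F[of x] that by simp
    show "isCont D x" if x: "(0::ereal) < ereal x" for x
    proof -
      have x: "0 < x" using x by simp
      let ?D = "\<lambda>x. of_real (x powr (p - 1) * exp (- x) / Gamma p) * exp (- (v * of_real x))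
         - (1 + v) * (of_real (x powr p * exp (- x) / Gamma (p + 1)) * exp (- (v * of_real x)))"
      have "isCont ?D x" using x p by (intro continuous_intros) (auto simp: Gamma_eq_zero_iff)
      moreover have "\<forall>\<^sub>F y in nhds x. ?D y = D y"
        using eventually_nhds_in_open[of "{0<..}" x] x by (auto elim!: eventually_mono simp: D_def gamma_density_def)
      ultimately show ?thesis by (rule isCont_cong[THEN iffD1, rotated])
    qed
    show "set_integrable lborel (einterval 0 \<infinity>) D"
      unfolding set_integrable_def using D by (rule integrable_mult_indicator[rotated]) auto
  qed (use lim0 liminf in auto)
  also have "(LBINT x=0..\<infinity>. D x) = (\<integral>x. D x \<partial>lborel)"
    unfolding interval_lebesgue_integral_0_infty set_lebesgue_integral_def
    by (intro Bochner_Integration.integral_cong) (auto simp: D_def gamma_density_def indicator_def)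
  also have "\<dots> = (\<integral>x. ?I p x \<partial>lborel) - (1 + v) * (\<integral>x. ?I (p + 1) x \<partial>lborel)"
    unfolding D_def using assms
    by (subst Bochner_Integration.integral_diff) (auto intro!: integrable_gamma_exp integrable_mult_right)
  finally show ?thesis by simp
qed

lemma one_plus_not_nonpos_Reals: "0 \<le> Re z \<Longrightarrow> 1 + z \<notin> \<real>\<^sub>\<le>\<^sub>0"
  by (auto simp: complex_nonpos_Reals_iff)

text \<open>
  Along the ray \<open>t v\<close>, differentiation and integration by parts show that the transform \<open>F\<close> solves
  \<open>F' = - p v / (1 + t v) F\<close> with \<open>F(0) = 1\<close>, and so does \<open>exp (- p Ln (1 + t v))\<close>.
\<close>

lemma gamma_complex_laplace:
  fixes v :: complex
  assumes p: "0 < p" and v: "0 \<le> Re v"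
  shows "(\<integral>x. of_real (gamma_density p x) * exp (- (v * of_real x)) \<partial>lborel) = exp (- (of_real p * Ln (1 + v)))"
proof -
  define F where "F q t = (\<integral>x. of_real (gamma_density q x) * exp (- ((of_real t * v) * of_real x)) \<partial>lborel)" for q t
  define G where "G t = exp (of_real p * Ln (1 + of_real t * v)) * F p t" for t
  have Re: "0 \<le> Re (of_real t * v)" if "0 \<le> t" for t using v that by simp
  have dF: "(F p has_vector_derivative - (of_real p * v / (1 + of_real t * v)) * F p t) (at t)" if t: "0 < t" for t
  proof -
    have "(F p has_vector_derivative
      (\<integral>x. of_real (gamma_density p x) * (- (v * of_real x) * exp (- ((of_real t * v) * of_real x))) \<partial>lborel)) (at t)"
      unfolding F_def
    proof (rule has_vector_derivative_integral_dominated[where a=0 and b="t + 1"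
          and B="\<lambda>x. cmod v * (p * gamma_density (p + 1) x)"])
      fix s x assume s: "0 < s" "s < t + 1"
      show "((\<lambda>s. of_real (gamma_density p x) * exp (- ((of_real s * v) * of_real x))) has_vector_derivative
          of_real (gamma_density p x) * (- (v * of_real x) * exp (- ((of_real s * v) * of_real x)))) (at s)"
        by (rule has_vector_derivative_real_field[where f="\<lambda>z. of_real (gamma_density p x) * exp (- ((z * v) * of_real x))"])
           (auto intro!: derivative_eq_intros)
      show "norm (of_real (gamma_density p x) * (- (v * of_real x) * exp (- ((of_real s * v) * of_real x))))
         \<le> cmod v * (p * gamma_density (p + 1) x)"
      proof (cases "0 < x")
        case True
        have e: "cmod (exp (- ((of_real s * v) * of_real x))) \<le> 1"
          using True s by (intro cmod_exp_gamma_le_1 Re) auto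
        have "norm (of_real (gamma_density p x) * (- (v * of_real x) * exp (- ((of_real s * v) * of_real x))))
            = cmod v * (x * gamma_density p x) * cmod (exp (- ((of_real s * v) * of_real x)))"
          using True gamma_density_nonneg[OF p, of x] by (simp add: norm_mult)
        also have "\<dots> \<le> cmod v * (x * gamma_density p x)"
          using e True gamma_density_nonneg[OF p, of x] by (intro mult_left_le) auto
        finally show ?thesis by (simp add: mult_gamma_density[OF p])
      qed (simp add: gamma_density_def)
    next
      fix s assume "0 < s" "s < t + 1"
      then show "complex_integrable lborel (\<lambda>x. of_real (gamma_density p x) * exp (- ((of_real s * v) * of_real x)))"
        using p Re by (intro integrable_gamma_exp) auto
    qed (use t p in \<open>auto intro!: integrable_mult_right integrable_gamma_density\<close>)
    also have "(\<lambda>x. of_real (gamma_density p x) * (- (v * of_real x) * exp (- ((of_real t * v) * of_real x)))) =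
       (\<lambda>x. - (of_real p * v) * (of_real (gamma_density (p + 1) x) * exp (- ((of_real t * v) * of_real x))))"
    proof
      fix x
      have "of_real x * of_real (gamma_density p x) = (of_real p * of_real (gamma_density (p + 1) x) :: complex)"
        unfolding of_real_mult[symmetric] mult_gamma_density[OF p] ..
      then show "of_real (gamma_density p x) * (- (v * of_real x) * exp (- ((of_real t * v) * of_real x))) =
        - (of_real p * v) * (of_real (gamma_density (p + 1) x) * exp (- ((of_real t * v) * of_real x)))"
        by (simp add: algebra_simps)
    qed
    also have "(\<integral>x. - (of_real p * v) * (of_real (gamma_density (p + 1) x) * exp (- ((of_real t * v) * of_real x))) \<partial>lborel)
       = - (of_real p * v) * F (p + 1) t"
      unfolding F_def by simp
    also have "\<dots> = - (of_real p * v / (1 + of_real t * v)) * F p t"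
    proof -
      have "(1 + of_real t * v) * F (p + 1) t = F p t"
        unfolding F_def using p Re t by (intro gamma_exp_parts) auto
      moreover have "1 + of_real t * v \<noteq> 0"
        using one_plus_not_nonpos_Reals[OF Re, of t] t by auto
      ultimately show ?thesis by (simp add: field_simps)
    qed
    finally show ?thesis .
  qed
  have dG: "(G has_vector_derivative 0) (at t)" if t: "0 < t" for t
  proof -
    have nz: "1 + of_real t * v \<notin> \<real>\<^sub>\<le>\<^sub>0" using one_plus_not_nonpos_Reals[OF Re, of t] t by auto
    have "((\<lambda>t. exp (of_real p * Ln (1 + of_real t * v))) has_vector_derivative
       of_real p * v / (1 + of_real t * v) * exp (of_real p * Ln (1 + of_real t * v))) (at t)"
      by (rule has_vector_derivative_real_field[where f="\<lambda>z. exp (of_real p * Ln (1 + z * v))"])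
         (use nz in \<open>auto intro!: derivative_eq_intros simp: field_simps\<close>)
    from has_vector_derivative_mult[OF this dF[OF t]]
    show ?thesis unfolding G_def by (simp add: algebra_simps)
  qed
  have contF: "continuous_on {0..1} (F p)"
    unfolding continuous_on_sequentially
  proof (intro allI ballI impI, elim conjE)
    fix X a assume X: "\<forall>n. X n \<in> {0..1::real}" "X \<longlonglongrightarrow> a"
    show "(F p \<circ> X) \<longlonglongrightarrow> F p a"
      unfolding F_def comp_def
    proof (rule integral_dominated_convergence[where w="gamma_density p"])
      show "AE x in lborel. norm (of_real (gamma_density p x) * exp (- (of_real (X n) * v * of_real x))) \<le> gamma_density p x" for n
        using X by (intro AE_I2 norm_gamma_exp_le[OF p] Re) auto
    qed (use p X in \<open>auto intro!: integrable_gamma_density tendsto_intros\<close>)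
  qed
  have "continuous_on {0..1} G"
    unfolding G_def using one_plus_not_nonpos_Reals[OF Re] by (intro continuous_intros contF) auto
  have "G 1 = G 0"
  proof (rule has_derivative_zero_unique_strong_interval[where k="{0, 1}" and a=0 and b=1])
    show "continuous_on {0..1} G" by fact
    show "(G has_derivative (\<lambda>h. 0)) (at x within {0..1})" if "x \<in> {0..1} - {0, 1}" for x
      using dG[of x] that by (auto simp: has_vector_derivative_def intro!: has_derivative_at_withinI)
  qed auto
  moreover have "F p 0 = 1"
    unfolding F_def using integral_gamma_density[OF p] by simp
  ultimately have "exp (of_real p * Ln (1 + v)) * F p 1 = 1"
    by (simp add: G_def)
  then show ?thesis unfolding F_def by (simp add: exp_minus field_simps)
qed

section \<open>Measurability of integrals on the space of boundedly finite measures\<close>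

lemma nn_integral_measurable_bf_measures [measurable]:
  assumes "f \<in> borel_measurable borel"
  shows "(\<lambda>m. \<integral>\<^sup>+x. f x \<partial>m) \<in> borel_measurable bf_measures"
  using assms
proof induct
  case (cong f g)
  have "(\<lambda>m. \<integral>\<^sup>+x. f x \<partial>m) = (\<lambda>m. \<integral>\<^sup>+x. g x \<partial>m)" using cong by (intro ext nn_integral_cong) auto
  with cong show ?case by simp
next
  case (set B)
  then have "(\<lambda>m. \<integral>\<^sup>+x. indicator B x \<partial>m) \<in> borel_measurable bf_measures \<longleftrightarrow> (\<lambda>m. emeasure m B) \<in> borel_measurable bf_measures"
    by (intro measurable_cong nn_integral_indicator) (simp add: space_bf_measures boundedly_finite_def)
  with set show ?case by simp
next
  case (mult f c)
  then have "(\<lambda>m. \<integral>\<^sup>+x. c * f x \<partial>m) \<in> borel_measurable bf_measures \<longleftrightarrow> (\<lambda>m. c * \<integral>\<^sup>+x. f x \<partial>m) \<in> borel_measurable bf_measures"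
    by (intro measurable_cong nn_integral_cmult)
       (simp add: space_bf_measures boundedly_finite_def cong: measurable_cong_sets)
  with mult show ?case by simp
next
  case (add f g)
  then have "(\<lambda>m. \<integral>\<^sup>+x. f x + g x \<partial>m) \<in> borel_measurable bf_measures \<longleftrightarrow>
      (\<lambda>m. (\<integral>\<^sup>+x. f x \<partial>m) + (\<integral>\<^sup>+x. g x \<partial>m)) \<in> borel_measurable bf_measures"
    by (intro measurable_cong nn_integral_add)
       (simp_all add: space_bf_measures boundedly_finite_def cong: measurable_cong_sets)
  with add show ?case by (simp add: ac_simps)
next
  case (seq F)
  then have "(\<lambda>m. \<integral>\<^sup>+x. (SUP i. F i) x \<partial>m) \<in> borel_measurable bf_measures \<longleftrightarrow>
      (\<lambda>m. SUP i. (\<integral>\<^sup>+x. F i x \<partial>m)) \<in> borel_measurable bf_measures"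
    unfolding SUP_apply
    by (intro measurable_cong nn_integral_monotone_convergence_SUP)
       (simp_all add: space_bf_measures boundedly_finite_def cong: measurable_cong_sets)
  with seq show ?case by (simp add: ac_simps)
qed

text \<open>
  The set of measures for which \<open>g\<close> fails to be integrable is measurable, and there the integral is 0.
\<close>

lemma integral_measurable_bf_measures [measurable]:
  fixes g :: "'a::polish_space \<Rightarrow> real"
  assumes [measurable]: "g \<in> borel_measurable borel"
  shows "(\<lambda>m. \<integral>x. g x \<partial>m) \<in> borel_measurable bf_measures"
proof -
  have "(\<integral>x. g x \<partial>m) = (if (\<integral>\<^sup>+x. ennreal (norm (g x)) \<partial>m) < \<infinity>
      then enn2real (\<integral>\<^sup>+x. ennreal (g x) \<partial>m) - enn2real (\<integral>\<^sup>+x. ennreal (- g x) \<partial>m) else 0)"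
    if "m \<in> space bf_measures" for m
  proof -
    have [simp]: "sets m = sets borel" using that by (simp add: space_bf_measures boundedly_finite_def)
    have "integrable m g \<longleftrightarrow> (\<integral>\<^sup>+x. ennreal (norm (g x)) \<partial>m) < \<infinity>"
      by (simp add: integrable_iff_bounded cong: measurable_cong_sets)
    then show ?thesis
      using real_lebesgue_integral_def[of m g] not_integrable_integral_eq[of m g] by auto
  qed
  then show ?thesis
    by (subst measurable_cong[where g="\<lambda>m. if (\<integral>\<^sup>+x. ennreal (norm (g x)) \<partial>m) < \<infinity>
      then enn2real (\<integral>\<^sup>+x. ennreal (g x) \<partial>m) - enn2real (\<integral>\<^sup>+x. ennreal (- g x) \<partial>m) else 0"]) auto
qed

lemma measure_measurable_bf_measures [measurable]:
  "A \<in> sets borel \<Longrightarrow> (\<lambda>m. measure m A) \<in> borel_measurable bf_measures"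
  unfolding measure_def by (intro borel_measurable_enn2real measurable_emeasure_bf_measures)

section \<open>Gamma processes integrated against simple functions\<close>

text \<open>
  On the right half plane the logarithm of \<open>1 + z\<close> grows as slowly as the real function
  \<open>ln (1 + r)\<close>; this is how the logarithmic moment condition controls the exponents.
\<close>

lemma norm_Ln_one_plus_le:
  assumes "0 \<le> Re z"
  shows "norm (Ln (1 + z)) \<le> ln (1 + norm z) + pi"
proof -
  have "1 \<le> Re (1 + z)" using assms by simp
  then have 1: "1 \<le> norm (1 + z)" using complex_Re_le_cmod[of "1 + z"] by linarith
  then have nz: "1 + z \<noteq> 0" by auto
  have "norm (Ln (1 + z)) \<le> \<bar>Re (Ln (1 + z))\<bar> + \<bar>Im (Ln (1 + z))\<bar>" by (rule cmod_le)
  also have "\<bar>Re (Ln (1 + z))\<bar> \<le> ln (1 + norm z)"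
    using 1 nz norm_triangle_ineq[of 1 z] by simp
  also have "\<bar>Im (Ln (1 + z))\<bar> \<le> pi"
    using Im_Ln_le_pi[OF nz] mpi_less_Im_Ln[OF nz] by linarith
  finally show ?thesis by simp
qed

lemma borel_measurable_Ln_one_plus:
  assumes "f \<in> borel_measurable M" "\<And>x. x \<in> space M \<Longrightarrow> 0 \<le> Re (f x)"
  shows "(\<lambda>x. Ln (1 + f x)) \<in> borel_measurable M"
proof -
  have "continuous_on {z. 0 \<le> Re z} (\<lambda>z. Ln (1 + z))"
    using one_plus_not_nonpos_Reals by (intro continuous_intros) auto
  then have "(\<lambda>z. Ln (1 + z)) \<in> borel_measurable (restrict_space borel {z. 0 \<le> Re z})"
    by (rule borel_measurable_continuous_on_restrict)
  moreover have "f \<in> measurable M (restrict_space borel {z. 0 \<le> Re z})"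
    using assms by (intro measurable_restrict_space2) auto
  ultimately show ?thesis by (rule measurable_compose[rotated])
qed

lemma integral_simple_function_comp:
  fixes f :: "'a \<Rightarrow> 'b" and k :: "'b \<Rightarrow> complex"
  assumes m: "finite_measure m" and [simp]: "space m = UNIV" and f: "simple_function m f"
  shows "(\<integral>x. k (f x) \<partial>m) = (\<Sum>v\<in>range f. of_real (measure m (f -` {v})) * k v)"
proof -
  interpret finite_measure m by fact
  have fin: "finite (range f)" using simple_functionD(1)[OF f] by simp
  have s: "f -` {v} \<in> sets m" for v using simple_functionD(2)[OF f, of "{v}"] by simp
  have "k (f x) = (\<Sum>v\<in>range f. of_real (indicator (f -` {v}) x) * k v)" for x
    using fin by (subst sum.remove[of _ "f x"]) (auto intro!: sum.neutral simp: indicator_def)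
  then have "(\<integral>x. k (f x) \<partial>m) = (\<integral>x. (\<Sum>v\<in>range f. of_real (indicator (f -` {v}) x) * k v) \<partial>m)" by simp
  also have "\<dots> = (\<Sum>v\<in>range f. of_real (measure m (f -` {v})) * k v)"
    using s by (subst Bochner_Integration.integral_sum)
      (auto intro!: integrable_mult_left integrable_of_real integrable_real_indicator simp: emeasure_finite less_top[symmetric])
  finally show ?thesis .
qed

lemma gamma_process_mass_laplace:
  assumes gp: "gamma_process P \<alpha> \<mu>" and A: "A \<in> sets borel" and v: "0 \<le> Re v"
  shows "(\<integral>w. exp (- (v * of_real (measure (\<mu> w) A))) \<partial>P) = exp (- (of_real (measure \<alpha> A) * Ln (1 + v)))"
proof -
  let ?h = "\<lambda>x. exp (- (v * of_real (enn2real x)))"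
  have mu: "\<mu> \<in> measurable P bf_measures" using gp by (simp add: gamma_process_def)
  have E: "(\<lambda>w. emeasure (\<mu> w) A) \<in> borel_measurable P"
    using measurable_compose[OF mu measurable_emeasure_bf_measures[OF A]] .
  have d: "distr P borel (\<lambda>w. emeasure (\<mu> w) A) = distr (gamma_distribution (measure \<alpha> A)) borel ennreal"
    using gp A by (simp add: gamma_process_def)
  have sg: "sets (gamma_distribution p) = sets borel" for p by (simp add: gamma_distribution_def)
  have "(\<integral>w. exp (- (v * of_real (measure (\<mu> w) A))) \<partial>P) = (\<integral>w. ?h (emeasure (\<mu> w) A) \<partial>P)"
    by (simp add: measure_def)
  also have "\<dots> = (\<integral>x. ?h x \<partial>distr P borel (\<lambda>w. emeasure (\<mu> w) A))"
    by (rule integral_distr[symmetric, OF E]) measurable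
  also have "\<dots> = (\<integral>x. ?h (ennreal x) \<partial>gamma_distribution (measure \<alpha> A))"
    unfolding d by (rule integral_distr) (auto simp: measurable_cong_sets[OF sg refl])
  also have "\<dots> = exp (- (of_real (measure \<alpha> A) * Ln (1 + v)))"
  proof (cases "measure \<alpha> A = 0")
    case True
    then show ?thesis by (simp add: gamma_distribution_def integral_return)
  next
    case False
    then have p: "0 < measure \<alpha> A" by (simp add: zero_less_measure_iff measure_nonneg less_le)
    have "(\<integral>x. ?h (ennreal x) \<partial>gamma_distribution (measure \<alpha> A)) =
        (\<integral>x. gamma_density (measure \<alpha> A) x *\<^sub>R ?h (ennreal x) \<partial>lborel)"
      unfolding gamma_distribution_def using False p
      by (simp add: integral_density gamma_density_nonneg)
    also have "\<dots> = (\<integral>x. of_real (gamma_density (measure \<alpha> A) x) * exp (- (v * of_real x)) \<partial>lborel)"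
      by (intro Bochner_Integration.integral_cong) (auto simp: gamma_density_def scaleR_conv_of_real)
    finally show ?thesis using gamma_complex_laplace[OF p v] by simp
  qed
  finally show ?thesis .
qed

lemma gamma_process_AE_finite:
  assumes gp: "gamma_process P \<alpha> \<mu>"
  shows "AE w in P. finite_measure (\<mu> w)"
proof -
  have mu: "\<mu> \<in> measurable P bf_measures" using gp by (simp add: gamma_process_def)
  have E: "(\<lambda>w. emeasure (\<mu> w) UNIV) \<in> borel_measurable P"
    using measurable_compose[OF mu measurable_emeasure_bf_measures[of UNIV]] by simp
  have d: "distr P borel (\<lambda>w. emeasure (\<mu> w) UNIV) = distr (gamma_distribution (measure \<alpha> UNIV)) borel ennreal"
    using gp by (simp add: gamma_process_def)
  have sg: "sets (gamma_distribution p) = sets borel" for p by (simp add: gamma_distribution_def)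
  have "AE x in distr P borel (\<lambda>w. emeasure (\<mu> w) UNIV). x \<noteq> \<infinity>"
    unfolding d by (subst AE_distr_iff) (auto simp: measurable_cong_sets[OF sg refl])
  then have "AE w in P. emeasure (\<mu> w) UNIV \<noteq> \<infinity>"
    by (subst (asm) AE_distr_iff[OF E]) auto
  then show ?thesis
  proof (rule AE_mp, intro AE_I2 impI)
    fix w assume w: "w \<in> space P" "emeasure (\<mu> w) UNIV \<noteq> \<infinity>"
    have "sets (\<mu> w) = sets borel"
      using measurable_space[OF mu w(1)] by (simp add: space_bf_measures boundedly_finite_def)
    then have "space (\<mu> w) = UNIV" by (metis sets_eq_imp_space_eq space_borel)
    with w show "finite_measure (\<mu> w)" by (intro finite_measureI) simp
  qed
qed

text \<open>
  The level sets of a simple function partition the space, so the exponential of the integral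
  factors into independent gamma variables. The integral is spelled out as a finite sum because the
  sum is a measurable function of the sample point even where the measure is infinite.
\<close>

lemma gamma_process_simple_laplace:
  fixes f :: "'a::polish_space \<Rightarrow> complex"
  assumes gp: "gamma_process P \<alpha> \<mu>" and \<alpha>: "finite_measure \<alpha>" "sets \<alpha> = sets borel"
    and f: "simple_function borel f" and Re: "\<And>x. 0 \<le> Re (f x)"
  shows "(\<integral>w. exp (- (\<Sum>v\<in>range f. of_real (measure (\<mu> w) (f -` {v})) * v)) \<partial>P) = exp (- (\<integral>x. Ln (1 + f x) \<partial>\<alpha>))"
proof -
  interpret prob_space P using gp by (simp add: gamma_process_def)
  have [measurable]: "\<mu> \<in> measurable P bf_measures" using gp by (simp add: gamma_process_def)
  have fin: "finite (range f)" using simple_functionD(1)[OF f] by simp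
  have s: "f -` {v} \<in> sets borel" for v using simple_functionD(2)[OF f, of "{v}"] by simp
  from ex_bij_betw_nat_finite[OF fin] obtain h where h: "bij_betw h {0..<card (range f)} (range f)" by blast
  define n where "n = card (range f)"
  have h: "bij_betw h {..<n} (range f)" using h by (simp add: n_def lessThan_atLeast0)
  define A where "A i = f -` {h i}" for i
  have dis: "disjoint_family_on A {..<n}"
    using h by (auto simp: disjoint_family_on_def A_def bij_betw_def inj_on_def)
  have Reh: "0 \<le> Re (h i)" if "i < n" for i
  proof -
    have "h i \<in> range f" using h that by (auto simp: bij_betw_def)
    with Re show ?thesis by auto
  qed
  have "indep_vars (\<lambda>_. borel) (\<lambda>i w. emeasure (\<mu> w) (A i)) {..<n}"
    using gp dis s unfolding gamma_process_def by (metis A_def)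
  then have ind: "indep_vars (\<lambda>_. borel) (\<lambda>i w. exp (- (h i * of_real (enn2real (emeasure (\<mu> w) (A i)))))) {..<n}"
    by (rule indep_vars_compose2) measurable
  have "(\<integral>w. exp (- (\<Sum>v\<in>range f. of_real (measure (\<mu> w) (f -` {v})) * v)) \<partial>P)
      = (\<integral>w. (\<Prod>i<n. exp (- (h i * of_real (enn2real (emeasure (\<mu> w) (A i)))))) \<partial>P)"
    by (subst sum.reindex_bij_betw[OF h, symmetric])
       (simp add: sum_negf[symmetric] exp_sum A_def measure_def mult.commute)
  also have "\<dots> = (\<Prod>i<n. \<integral>w. exp (- (h i * of_real (enn2real (emeasure (\<mu> w) (A i))))) \<partial>P)"
  proof (rule indep_vars_lebesgue_integral[OF _ ind])
    fix i assume "i \<in> {..<n}"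
    then show "integrable P (\<lambda>w. exp (- (h i * of_real (enn2real (emeasure (\<mu> w) (A i))))))"
      using Reh[of i] ind by (intro integrable_const_bound[of _ 1]) (auto simp: indep_vars_def)
  qed simp
  also have "\<dots> = (\<Prod>i<n. exp (- (of_real (measure \<alpha> (A i)) * Ln (1 + h i))))"
  proof (rule prod.cong[OF refl])
    fix i assume "i \<in> {..<n}"
    then show "(\<integral>w. exp (- (h i * of_real (enn2real (emeasure (\<mu> w) (A i))))) \<partial>P) = exp (- (of_real (measure \<alpha> (A i)) * Ln (1 + h i)))"
      using gamma_process_mass_laplace[OF gp, of "A i" "h i"] Reh[of i] s by (simp add: A_def measure_def)
  qed
  also have "\<dots> = exp (- (\<Sum>v\<in>range f. of_real (measure \<alpha> (f -` {v})) * Ln (1 + v)))"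
    by (subst sum.reindex_bij_betw[OF h, symmetric]) (simp add: sum_negf[symmetric] exp_sum A_def)
  also have "(\<Sum>v\<in>range f. of_real (measure \<alpha> (f -` {v})) * Ln (1 + v)) = (\<integral>x. Ln (1 + f x) \<partial>\<alpha>)"
    using integral_simple_function_comp[of \<alpha> f "\<lambda>v. Ln (1 + v)"] \<alpha> f sets_eq_imp_space_eq[OF \<alpha>(2)]
    by (simp add: simple_function_def)
  finally show ?thesis .
qed

section \<open>Almost sure integrability\<close>

text \<open>
  The continuous extension of \<open>exp (- s x)\<close> to infinity, with value 0 there: its expectation detects
  the event that a nonnegative variable is infinite.
\<close>

definition exp_neg_ennreal :: "real \<Rightarrow> ennreal \<Rightarrow> real" where
  "exp_neg_ennreal s x = (if x = \<infinity> then 0 else exp (- (s * enn2real x)))"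

lemma exp_neg_ennreal_measurable [measurable]: "exp_neg_ennreal s \<in> borel_measurable borel"
  unfolding exp_neg_ennreal_def by measurable

lemma exp_neg_ennreal_bounds: "0 \<le> s \<Longrightarrow> 0 \<le> exp_neg_ennreal s x \<and> exp_neg_ennreal s x \<le> 1"
  by (simp add: exp_neg_ennreal_def)

lemma tendsto_exp_neg_ennreal:
  assumes s: "0 < s" and X: "X \<longlonglongrightarrow> x"
  shows "(\<lambda>n. exp_neg_ennreal s (X n)) \<longlonglongrightarrow> exp_neg_ennreal s x"
proof (cases "x = \<infinity>")
  case False
  then have "\<forall>\<^sub>F n in sequentially. X n < \<infinity>"
    using X by (intro order_tendstoD(2)) (auto simp: less_top)
  then have "\<forall>\<^sub>F n in sequentially. exp (- (s * enn2real (X n))) = exp_neg_ennreal s (X n)"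
    by eventually_elim (auto simp: exp_neg_ennreal_def)
  moreover have "(\<lambda>n. exp (- (s * enn2real (X n)))) \<longlonglongrightarrow> exp (- (s * enn2real x))"
    using False X by (intro tendsto_intros) (simp_all add: less_top)
  ultimately show ?thesis using False
    by (auto simp: exp_neg_ennreal_def intro: Lim_transform_eventually)
next
  case True
  show ?thesis
  proof (rule LIMSEQ_I)
    fix r :: real assume r: "0 < r"
    \<comment> \<open>beyond \<open>b\<close> the exponential is below \<open>r\<close>\<close>
    define b where "b = max 0 (- ln r / s) + 1"
    have b0: "0 \<le> b" by (simp add: b_def)
    have "\<forall>\<^sub>F n in sequentially. ennreal b < X n"
      using X True by (intro order_tendstoD(1)) (auto simp: less_top[symmetric])
    then obtain N where N: "\<And>n. n \<ge> N \<Longrightarrow> ennreal b < X n" by (auto simp: eventually_sequentially)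
    have "norm (exp_neg_ennreal s (X n) - exp_neg_ennreal s x) < r" if "n \<ge> N" for n
    proof (cases "X n = \<infinity>")
      case False
      then have "b < enn2real (X n)"
        using N[OF that] b0 by (cases "X n") (auto simp: ennreal_less_iff)
      moreover have "- ln r / s < b" by (simp add: b_def)
      ultimately have "- ln r / s < enn2real (X n)" by linarith
      then have "- (s * enn2real (X n)) < ln r" using s by (simp add: field_simps)
      then have "exp (- (s * enn2real (X n))) < r" using r by (metis exp_less_mono exp_ln)
      then show ?thesis using False True by (simp add: exp_neg_ennreal_def)
    qed (use True r in \<open>simp add: exp_neg_ennreal_def\<close>)
    then show "\<exists>N. \<forall>n\<ge>N. norm (exp_neg_ennreal s (X n) - exp_neg_ennreal s x) < r" by blast
  qed
qed

lemma integrable_log_one_plus: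
  fixes g :: "'a::polish_space \<Rightarrow> real"
  assumes \<alpha>: "sets \<alpha> = sets borel" and g [measurable]: "g \<in> borel_measurable borel"
    and fin: "(\<integral>\<^sup>+x. ennreal (ln (1 + \<bar>g x\<bar>)) \<partial>\<alpha>) < \<infinity>"
  shows "integrable \<alpha> (\<lambda>x. ln (1 + \<bar>g x\<bar>))"
  using fin \<alpha> by (intro integrableI_nonneg) (auto cong: measurable_cong_sets)

text \<open>
  For simple \<open>h \<le> s \<bar>g\<bar>\<close> the transform is exactly \<open>exp (- \<integral> ln (1 + h) d\<alpha>)\<close>, which is at least the
  stated bound; letting \<open>h\<close> increase to \<open>s \<bar>g\<bar>\<close> preserves the inequality by monotone convergence of the
  integrals against \<open>\<mu> w\<close>.
\<close>

lemma gamma_process_laplace_le: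
  fixes g :: "'a::polish_space \<Rightarrow> real"
  assumes gp: "gamma_process P \<alpha> \<mu>" and \<alpha>: "finite_measure \<alpha>" "sets \<alpha> = sets borel"
    and g [measurable]: "g \<in> borel_measurable borel"
    and fin: "(\<integral>\<^sup>+x. ennreal (ln (1 + \<bar>g x\<bar>)) \<partial>\<alpha>) < \<infinity>"
    and s: "0 < s" "s \<le> 1"
  shows "exp (- (\<integral>x. ln (1 + s * \<bar>g x\<bar>) \<partial>\<alpha>)) \<le> (\<integral>w. exp_neg_ennreal s (\<integral>\<^sup>+x. ennreal \<bar>g x\<bar> \<partial>\<mu> w) \<partial>P)"
proof -
  interpret prob_space P using gp by (simp add: gamma_process_def)
  have mu [measurable]: "\<mu> \<in> measurable P bf_measures" using gp by (simp add: gamma_process_def)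
  have sm: "sets (\<mu> w) = sets borel" if "w \<in> space P" for w
    using measurable_space[OF mu that] by (simp add: space_bf_measures boundedly_finite_def)
  have spm: "space (\<mu> w) = UNIV" if "w \<in> space P" for w
    using sets_eq_imp_space_eq[OF sm[OF that]] by simp
  note [measurable_cong] = \<alpha>(2)
  have int: "integrable \<alpha> (\<lambda>x. ln (1 + s * \<bar>g x\<bar>))"
    by (rule Bochner_Integration.integrable_bound[OF integrable_log_one_plus[OF \<alpha>(2) g fin]])
       (use s in \<open>auto intro!: AE_I2 simp: mult_left_le_one_le add_pos_nonneg\<close>)
  obtain f where f: "incseq f" "\<And>i. simple_function borel (f i)" "\<And>i x. f i x < top"
      "(\<lambda>x. ennreal \<bar>g x\<bar>) = (SUP i. f i)"
    using borel_measurable_implies_simple_function_sequence[of "\<lambda>x. ennreal \<bar>g x\<bar>" borel] by auto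
  define h where "h i x = s * enn2real (f i x)" for i x
  have [measurable]: "f i \<in> borel_measurable borel" for i using f(2) by (rule borel_measurable_simple_function)
  have hs: "simple_function borel (\<lambda>x. complex_of_real (h i x))" for i
    unfolding h_def by (intro simple_function_compose1[where g="\<lambda>y. complex_of_real (s * enn2real y)"] f(2))
  have h0: "0 \<le> h i x" for i x using s by (simp add: h_def)
  have fle: "f i x \<le> ennreal \<bar>g x\<bar>" for i x
    using f(4) by (metis SUP_apply SUP_upper UNIV_I)
  have hle: "h i x \<le> s * \<bar>g x\<bar>" for i x
    using enn2real_mono[OF fle[of i x]] s by (simp add: h_def)
  have step: "exp (- (\<integral>x. ln (1 + s * \<bar>g x\<bar>) \<partial>\<alpha>)) \<le> (\<integral>w. exp_neg_ennreal s (\<integral>\<^sup>+x. f i x \<partial>\<mu> w) \<partial>P)" for i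
  proof -
    have "complex_of_real (\<integral>w. exp_neg_ennreal s (\<integral>\<^sup>+x. f i x \<partial>\<mu> w) \<partial>P) =
      (\<integral>w. complex_of_real (exp_neg_ennreal s (\<integral>\<^sup>+x. f i x \<partial>\<mu> w)) \<partial>P)" by simp
    also have "\<dots> = (\<integral>w. exp (- (\<Sum>v\<in>range (\<lambda>x. complex_of_real (h i x)). of_real (measure (\<mu> w) ((\<lambda>x. complex_of_real (h i x)) -` {v})) * v)) \<partial>P)"
    proof (rule integral_cong_AE)
      show "(\<lambda>w. complex_of_real (exp_neg_ennreal s (\<integral>\<^sup>+x. f i x \<partial>\<mu> w))) \<in> borel_measurable P" by measurable
      have "(\<lambda>x. complex_of_real (h i x)) -` {v} \<in> sets borel" for v using simple_functionD(2)[OF hs, of i "{v}"] by simp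
      note measurable_compose[OF mu measure_measurable_bf_measures[OF this], measurable]
      show "(\<lambda>w. exp (- (\<Sum>v\<in>range (\<lambda>x. complex_of_real (h i x)). of_real (measure (\<mu> w) ((\<lambda>x. complex_of_real (h i x)) -` {v})) * v))) \<in> borel_measurable P"
        by measurable
      show "AE w in P. complex_of_real (exp_neg_ennreal s (\<integral>\<^sup>+x. f i x \<partial>\<mu> w)) =
        exp (- (\<Sum>v\<in>range (\<lambda>x. complex_of_real (h i x)). of_real (measure (\<mu> w) ((\<lambda>x. complex_of_real (h i x)) -` {v})) * v))"
        using gamma_process_AE_finite[OF gp]
      proof (rule AE_mp, intro AE_I2 impI)
        fix w assume w: "w \<in> space P" and fm: "finite_measure (\<mu> w)"
        have sfm: "simple_function (\<mu> w) (f i)" using f(2)[of i] spm[OF w] sm[OF w] by (simp add: simple_function_def)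
        have shm: "simple_function (\<mu> w) (\<lambda>x. complex_of_real (h i x))" using hs[of i] spm[OF w] sm[OF w] by (simp add: simple_function_def)
        obtain C where C: "C < top" "\<And>x. f i x \<le> C"
        proof
          have fin: "finite (range (f i))" using simple_functionD(1)[OF f(2)[of i]] by simp
          show "f i x \<le> Max (range (f i))" for x using fin by (intro Max_ge) auto
          have "Max (range (f i)) \<in> range (f i)" using fin by (intro Max_in) auto
          then show "Max (range (f i)) < top" using f(3) by auto
        qed
        have "(\<integral>\<^sup>+x. f i x \<partial>\<mu> w) \<le> (\<integral>\<^sup>+x. C \<partial>\<mu> w)" by (intro nn_integral_mono C)
        also have "\<dots> < top" using C(1) finite_measure.emeasure_finite[OF fm, of UNIV] by (simp add: ennreal_mult_less_top less_top spm[OF w])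
        finally have fin: "(\<integral>\<^sup>+x. f i x \<partial>\<mu> w) < top" .
        have "(\<integral>x. enn2real (f i x) \<partial>\<mu> w) = enn2real (\<integral>\<^sup>+x. ennreal (enn2real (f i x)) \<partial>\<mu> w)"
          using borel_measurable_simple_function[OF sfm] by (intro integral_eq_nn_integral) auto
        also have "(\<integral>\<^sup>+x. ennreal (enn2real (f i x)) \<partial>\<mu> w) = (\<integral>\<^sup>+x. f i x \<partial>\<mu> w)"
          using f(3) by (intro nn_integral_cong) auto
        finally have "s * enn2real (\<integral>\<^sup>+x. f i x \<partial>\<mu> w) = (\<integral>x. h i x \<partial>\<mu> w)" by (simp add: h_def)
        moreover have "complex_of_real (\<integral>x. h i x \<partial>\<mu> w) = (\<integral>x. complex_of_real (h i x) \<partial>\<mu> w)" by simp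
        moreover have "\<dots> = (\<Sum>v\<in>range (\<lambda>x. complex_of_real (h i x)). of_real (measure (\<mu> w) ((\<lambda>x. complex_of_real (h i x)) -` {v})) * v)"
          using integral_simple_function_comp[OF fm spm[OF w] shm, of "\<lambda>v. v"] by simp
        ultimately show "complex_of_real (exp_neg_ennreal s (\<integral>\<^sup>+x. f i x \<partial>\<mu> w)) =
          exp (- (\<Sum>v\<in>range (\<lambda>x. complex_of_real (h i x)). of_real (measure (\<mu> w) ((\<lambda>x. complex_of_real (h i x)) -` {v})) * v))"
          using fin by (simp add: exp_neg_ennreal_def exp_of_real[symmetric])
      qed
    qed
    also have "\<dots> = exp (- (\<integral>x. Ln (1 + complex_of_real (h i x)) \<partial>\<alpha>))"
      using hs h0 by (intro gamma_process_simple_laplace[OF gp \<alpha>]) auto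
    also have "(\<integral>x. Ln (1 + complex_of_real (h i x)) \<partial>\<alpha>) = (\<integral>x. complex_of_real (ln (1 + h i x)) \<partial>\<alpha>)"
    proof (intro Bochner_Integration.integral_cong refl)
      fix x
      have "1 + h i x > 0" using h0[of i x] by simp
      from Ln_of_real[OF this] show "Ln (1 + complex_of_real (h i x)) = complex_of_real (ln (1 + h i x))" by simp
    qed
    also have "exp (- (\<integral>x. complex_of_real (ln (1 + h i x)) \<partial>\<alpha>)) = complex_of_real (exp (- (\<integral>x. ln (1 + h i x) \<partial>\<alpha>)))"
      by (simp add: exp_of_real[symmetric])
    finally have "(\<integral>w. exp_neg_ennreal s (\<integral>\<^sup>+x. f i x \<partial>\<mu> w) \<partial>P) = exp (- (\<integral>x. ln (1 + h i x) \<partial>\<alpha>))"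
      by (simp only: of_real_eq_iff)
    moreover have "(\<integral>x. ln (1 + h i x) \<partial>\<alpha>) \<le> (\<integral>x. ln (1 + s * \<bar>g x\<bar>) \<partial>\<alpha>)"
    proof (rule integral_mono)
      show le: "ln (1 + h i x) \<le> ln (1 + s * \<bar>g x\<bar>)" for x using hle[of i x] h0[of i x] by simp
      show "integrable \<alpha> (\<lambda>x. ln (1 + h i x))"
      proof (rule Bochner_Integration.integrable_bound[OF int])
        show "(\<lambda>x. ln (1 + h i x)) \<in> borel_measurable \<alpha>" unfolding h_def by measurable
        show "AE x in \<alpha>. norm (ln (1 + h i x)) \<le> norm (ln (1 + s * \<bar>g x\<bar>))"
          using le h0 by (intro AE_I2) (smt (verit) ln_ge_zero real_norm_def)
      qed
    qed (rule int)
    ultimately show ?thesis by simp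
  qed
  have "(\<lambda>i. \<integral>w. exp_neg_ennreal s (\<integral>\<^sup>+x. f i x \<partial>\<mu> w) \<partial>P) \<longlonglongrightarrow> (\<integral>w. exp_neg_ennreal s (\<integral>\<^sup>+x. ennreal \<bar>g x\<bar> \<partial>\<mu> w) \<partial>P)"
  proof (rule integral_dominated_convergence[where w="\<lambda>_. 1"])
    show "AE w in P. (\<lambda>i. exp_neg_ennreal s (\<integral>\<^sup>+x. f i x \<partial>\<mu> w)) \<longlonglongrightarrow> exp_neg_ennreal s (\<integral>\<^sup>+x. ennreal \<bar>g x\<bar> \<partial>\<mu> w)"
    proof (rule AE_I2)
      fix w assume w: "w \<in> space P"
      have "(\<lambda>i. \<integral>\<^sup>+x. f i x \<partial>\<mu> w) \<longlonglongrightarrow> (SUP i. \<integral>\<^sup>+x. f i x \<partial>\<mu> w)"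
        using f(1) by (intro LIMSEQ_SUP) (auto simp: incseq_def le_fun_def intro!: nn_integral_mono)
      also have "(SUP i. \<integral>\<^sup>+x. f i x \<partial>\<mu> w) = (\<integral>\<^sup>+x. (SUP i. f i x) \<partial>\<mu> w)"
        using f(1) sm[OF w] by (intro nn_integral_monotone_convergence_SUP[symmetric]) (auto cong: measurable_cong_sets)
      also have "(\<lambda>x. SUP i. f i x) = (\<lambda>x. ennreal \<bar>g x\<bar>)" unfolding f(4) by (rule ext) (simp only: SUP_apply)
      finally show "(\<lambda>i. exp_neg_ennreal s (\<integral>\<^sup>+x. f i x \<partial>\<mu> w)) \<longlonglongrightarrow> exp_neg_ennreal s (\<integral>\<^sup>+x. ennreal \<bar>g x\<bar> \<partial>\<mu> w)"
        by (rule tendsto_exp_neg_ennreal[OF s(1)])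
    qed
    show "AE w in P. norm (exp_neg_ennreal s (\<integral>\<^sup>+x. f i x \<partial>\<mu> w)) \<le> 1" for i
      using exp_neg_ennreal_bounds[of s] s by simp
  qed auto
  then show ?thesis using step by (intro LIMSEQ_le_const) auto
qed

text \<open>
  The transform at \<open>s\<close> of the integral of \<open>\<bar>g\<bar>\<close> is at most the probability that this integral is
  finite. As \<open>s\<close> tends to 0 the lower bound \<open>exp (- \<integral> ln (1 + s \<bar>g\<bar>) d\<alpha>)\<close> tends to 1.
\<close>

lemma gamma_process_AE_integrable:
  fixes g :: "'a::polish_space \<Rightarrow> real"
  assumes gp: "gamma_process P \<alpha> \<mu>" and \<alpha>: "finite_measure \<alpha>" "sets \<alpha> = sets borel"
    and g [measurable]: "g \<in> borel_measurable borel"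
    and fin: "(\<integral>\<^sup>+x. ennreal (ln (1 + \<bar>g x\<bar>)) \<partial>\<alpha>) < \<infinity>"
  shows "AE w in P. integrable (\<mu> w) g"
proof -
  interpret prob_space P using gp by (simp add: gamma_process_def)
  have mu [measurable]: "\<mu> \<in> measurable P bf_measures" using gp by (simp add: gamma_process_def)
  have sm: "sets (\<mu> w) = sets borel" if "w \<in> space P" for w
    using measurable_space[OF mu that] by (simp add: space_bf_measures boundedly_finite_def)
  note [measurable_cong] = \<alpha>(2)
  define F where "F = {w\<in>space P. (\<integral>\<^sup>+x. ennreal \<bar>g x\<bar> \<partial>\<mu> w) < \<infinity>}"
  have [measurable]: "F \<in> sets P" unfolding F_def by measurable
  let ?s = "\<lambda>n. inverse (real (Suc n))"
  have le: "exp (- (\<integral>x. ln (1 + ?s n * \<bar>g x\<bar>) \<partial>\<alpha>)) \<le> prob F" for n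
  proof -
    have "exp (- (\<integral>x. ln (1 + ?s n * \<bar>g x\<bar>) \<partial>\<alpha>)) \<le> (\<integral>w. exp_neg_ennreal (?s n) (\<integral>\<^sup>+x. ennreal \<bar>g x\<bar> \<partial>\<mu> w) \<partial>P)"
      by (rule gamma_process_laplace_le[OF gp \<alpha> g fin]) (auto simp: inverse_le_1_iff)
    also have "\<dots> \<le> (\<integral>w. indicator F w \<partial>P)"
    proof (rule integral_mono)
      show "integrable P (\<lambda>w. exp_neg_ennreal (?s n) (\<integral>\<^sup>+x. ennreal \<bar>g x\<bar> \<partial>\<mu> w))"
        using exp_neg_ennreal_bounds[of "?s n"] by (intro integrable_const_bound[of _ 1]) auto
      show "exp_neg_ennreal (?s n) (\<integral>\<^sup>+x. ennreal \<bar>g x\<bar> \<partial>\<mu> w) \<le> indicator F w" if "w \<in> space P" for w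
        using that exp_neg_ennreal_bounds[of "?s n"] by (auto simp: F_def indicator_def less_top[symmetric] exp_neg_ennreal_def)
    qed (auto simp: emeasure_eq_measure)
    finally show ?thesis by simp
  qed
  have "(\<lambda>n. \<integral>x. ln (1 + ?s n * \<bar>g x\<bar>) \<partial>\<alpha>) \<longlonglongrightarrow> (\<integral>x. 0 \<partial>\<alpha>)"
  proof (rule integral_dominated_convergence[OF _ _ integrable_log_one_plus[OF \<alpha>(2) g fin]])
    show "AE x in \<alpha>. (\<lambda>n. ln (1 + ?s n * \<bar>g x\<bar>)) \<longlonglongrightarrow> 0"
    proof (rule AE_I2)
      fix x
      have "(\<lambda>n. ln (1 + ?s n * \<bar>g x\<bar>)) \<longlonglongrightarrow> ln (1 + 0 * \<bar>g x\<bar>)"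
        by (intro tendsto_intros LIMSEQ_inverse_real_of_nat) simp
      then show "(\<lambda>n. ln (1 + ?s n * \<bar>g x\<bar>)) \<longlonglongrightarrow> 0" by simp
    qed
    show "AE x in \<alpha>. norm (ln (1 + ?s n * \<bar>g x\<bar>)) \<le> ln (1 + \<bar>g x\<bar>)" for n
    proof (rule AE_I2)
      fix x
      have "?s n * \<bar>g x\<bar> \<le> \<bar>g x\<bar>" by (intro mult_left_le_one_le) (auto simp: field_simps)
      moreover have "0 \<le> ?s n * \<bar>g x\<bar>" by simp
      ultimately have "0 \<le> ln (1 + ?s n * \<bar>g x\<bar>)" "ln (1 + ?s n * \<bar>g x\<bar>) \<le> ln (1 + \<bar>g x\<bar>)"
        by (simp_all only: ln_ge_zero_iff ln_le_cancel_iff)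
      then show "norm (ln (1 + ?s n * \<bar>g x\<bar>)) \<le> ln (1 + \<bar>g x\<bar>)" by simp
    qed
  qed measurable
  then have "(\<lambda>n. exp (- (\<integral>x. ln (1 + ?s n * \<bar>g x\<bar>) \<partial>\<alpha>))) \<longlonglongrightarrow> exp (- 0)"
    by (intro tendsto_intros) simp
  then have "exp (- 0) \<le> prob F" using le by (intro LIMSEQ_le_const2) auto
  then have "prob F = 1" using prob_le_1[of F] by simp
  then have "AE w in P. w \<in> F" by (subst (asm) prob_eq_1) auto
  then show ?thesis
  proof (rule AE_mp, intro AE_I2 impI)
    fix w assume "w \<in> space P" "w \<in> F"
    then show "integrable (\<mu> w) g" using sm[of w]
      by (simp add: integrable_iff_bounded F_def cong: measurable_cong_sets)
  qed
qed

section \<open>The joint transform of total mass and integral\<close>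

text \<open>
  Simple approximations of \<open>g\<close> by functions bounded by \<open>2 \<bar>g\<bar>\<close> give the transform for
  \<open>c - i f\<^sub>n\<close>. On the left the sums converge almost surely because \<open>g\<close> is integrable for almost every
  measure; on the right the logarithms are dominated by a constant plus \<open>ln (1 + \<bar>g\<bar>)\<close>.
\<close>

lemma gamma_process_functional:
  fixes g :: "'a::polish_space \<Rightarrow> real"
  assumes gp: "gamma_process P \<alpha> \<mu>" and \<alpha>: "finite_measure \<alpha>" "sets \<alpha> = sets borel"
    and g [measurable]: "g \<in> borel_measurable borel"
    and fin: "(\<integral>\<^sup>+x. ennreal (ln (1 + \<bar>g x\<bar>)) \<partial>\<alpha>) < \<infinity>"
    and c: "0 \<le> c"
  shows "(\<integral>w. exp (- of_real (c * measure (\<mu> w) UNIV) + \<i> * of_real (\<integral>x. g x \<partial>\<mu> w)) \<partial>P) =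
    exp (- (\<integral>x. Ln (1 + (of_real c - \<i> * of_real (g x))) \<partial>\<alpha>))"
proof -
  interpret prob_space P using gp by (simp add: gamma_process_def)
  interpret A: finite_measure \<alpha> by fact
  have mu [measurable]: "\<mu> \<in> measurable P bf_measures" using gp by (simp add: gamma_process_def)
  have sm: "sets (\<mu> w) = sets borel" if "w \<in> space P" for w
    using measurable_space[OF mu that] by (simp add: space_bf_measures boundedly_finite_def)
  have spm: "space (\<mu> w) = UNIV" if "w \<in> space P" for w
    using sets_eq_imp_space_eq[OF sm[OF that]] by simp
  note [measurable_cong] = \<alpha>(2)
  obtain f where f: "\<And>i. simple_function borel (f i)" "\<And>x. (\<lambda>i. f i x) \<longlonglongrightarrow> g x" "\<And>i x. \<bar>f i x\<bar> \<le> 2 * \<bar>g x\<bar>"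
    using borel_measurable_implies_sequence_metric[OF g, of 0] by auto
  have [measurable]: "f i \<in> borel_measurable borel" for i using f(1) by (rule borel_measurable_simple_function)
  define h where "h i x = of_real c - \<i> * of_real (f i x)" for i x
  define S where "S i w = (\<Sum>v\<in>range (h i). of_real (measure (\<mu> w) (h i -` {v})) * v)" for i w
  have hs: "simple_function borel (h i)" for i
    unfolding h_def by (intro simple_function_compose1[where g="\<lambda>y. of_real c - \<i> * of_real y"] f(1))
  have hm [measurable]: "h i \<in> borel_measurable borel" for i using hs by (rule borel_measurable_simple_function)
  have hRe: "Re (h i x) = c" for i x by (simp add: h_def)
  have hset: "h i -` {v} \<in> sets borel" for i v using simple_functionD(2)[OF hs, of i "{v}"] by simp
  note measurable_compose[OF mu measure_measurable_bf_measures[OF hset], measurable]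
  have Sm [measurable]: "S i \<in> borel_measurable P" for i unfolding S_def by measurable
  have gm [measurable]: "(\<lambda>w. \<integral>x. g x \<partial>\<mu> w) \<in> borel_measurable P"
    using measurable_compose[OF mu integral_measurable_bf_measures[OF g]] .
  have um [measurable]: "(\<lambda>w. measure (\<mu> w) UNIV) \<in> borel_measurable P"
    using measurable_compose[OF mu measure_measurable_bf_measures[of UNIV]] by simp
  have eq: "(\<integral>w. exp (- S i w) \<partial>P) = exp (- (\<integral>x. Ln (1 + h i x) \<partial>\<alpha>))" for i
    unfolding S_def using hRe c by (intro gamma_process_simple_laplace[OF gp \<alpha> hs]) simp
  have nS: "norm (exp (- S i w)) \<le> 1" for i w
  proof -
    have "0 \<le> (\<Sum>v\<in>range (h i). measure (\<mu> w) (h i -` {v}) * Re v)"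
      using hRe c by (intro sum_nonneg mult_nonneg_nonneg) auto
    then show ?thesis by (simp add: S_def)
  qed
  have "(\<lambda>i. \<integral>w. exp (- S i w) \<partial>P) \<longlonglongrightarrow>
    (\<integral>w. exp (- of_real (c * measure (\<mu> w) UNIV) + \<i> * of_real (\<integral>x. g x \<partial>\<mu> w)) \<partial>P)"
  proof (rule integral_dominated_convergence[where w="\<lambda>_. 1"])
    show "AE w in P. (\<lambda>i. exp (- S i w)) \<longlonglongrightarrow> exp (- of_real (c * measure (\<mu> w) UNIV) + \<i> * of_real (\<integral>x. g x \<partial>\<mu> w))"
      using gamma_process_AE_finite[OF gp] gamma_process_AE_integrable[OF gp \<alpha> g fin] AE_space
    proof eventually_elim
      case (elim w)
      note w = \<open>w \<in> space P\<close> and gi = \<open>integrable (\<mu> w) g\<close>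
      interpret W: finite_measure "\<mu> w" by (rule elim(1))
      note [measurable_cong] = sm[OF w]
      have S: "S i w = (\<integral>x. h i x \<partial>\<mu> w)" for i
        using integral_simple_function_comp[of "\<mu> w" "h i" "\<lambda>v. v"] elim(1) hs[of i] spm[OF w] sm[OF w]
        by (simp add: S_def simple_function_def)
      have "(\<lambda>i. \<integral>x. h i x \<partial>\<mu> w) \<longlonglongrightarrow> (\<integral>x. of_real c - \<i> * of_real (g x) \<partial>\<mu> w)"
      proof (rule integral_dominated_convergence[where w="\<lambda>x. c + 2 * \<bar>g x\<bar>"])
        show "integrable (\<mu> w) (\<lambda>x. c + 2 * \<bar>g x\<bar>)" using gi by simp
        show "AE x in \<mu> w. (\<lambda>i. h i x) \<longlonglongrightarrow> of_real c - \<i> * of_real (g x)"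
          unfolding h_def by (intro AE_I2 tendsto_intros f(2))
        show "AE x in \<mu> w. norm (h i x) \<le> c + 2 * \<bar>g x\<bar>" for i
        proof (rule AE_I2)
          fix x
          have "norm (h i x) \<le> norm (complex_of_real c) + norm (\<i> * of_real (f i x))"
            unfolding h_def by (rule norm_triangle_ineq4)
          then show "norm (h i x) \<le> c + 2 * \<bar>g x\<bar>" using f(3)[of i x] c by (simp add: norm_mult)
        qed
      qed measurable
      also have "(\<integral>x. of_real c - \<i> * of_real (g x) \<partial>\<mu> w) = of_real (c * measure (\<mu> w) UNIV) - \<i> * of_real (\<integral>x. g x \<partial>\<mu> w)"
        using gi by (subst Bochner_Integration.integral_diff) (auto simp: spm[OF w] scaleR_conv_of_real mult.commute)
      finally have "(\<lambda>i. S i w) \<longlonglongrightarrow> of_real (c * measure (\<mu> w) UNIV) - \<i> * of_real (\<integral>x. g x \<partial>\<mu> w)"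
        by (simp only: S)
      then have "(\<lambda>i. exp (- S i w)) \<longlonglongrightarrow> exp (- (of_real (c * measure (\<mu> w) UNIV) - \<i> * of_real (\<integral>x. g x \<partial>\<mu> w)))"
        by (intro tendsto_intros)
      then show ?case by simp
    qed
    show "AE w in P. norm (exp (- S i w)) \<le> 1" for i using nS by simp
  qed auto
  moreover have "(\<lambda>i. exp (- (\<integral>x. Ln (1 + h i x) \<partial>\<alpha>))) \<longlonglongrightarrow> exp (- (\<integral>x. Ln (1 + (of_real c - \<i> * of_real (g x))) \<partial>\<alpha>))"
  proof (intro tendsto_intros, rule integral_dominated_convergence[where w="\<lambda>x. (ln (1 + c) + ln 2 + ln (1 + \<bar>g x\<bar>)) + pi"])
    show "integrable \<alpha> (\<lambda>x. (ln (1 + c) + ln 2 + ln (1 + \<bar>g x\<bar>)) + pi)"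
      using integrable_log_one_plus[OF \<alpha>(2) g fin] by simp
    show "(\<lambda>x. Ln (1 + h i x)) \<in> borel_measurable \<alpha>" for i
      using hRe c by (intro borel_measurable_Ln_one_plus) auto
    show "(\<lambda>x. Ln (1 + (of_real c - \<i> * of_real (g x)))) \<in> borel_measurable \<alpha>"
      using c by (intro borel_measurable_Ln_one_plus) auto
    show "AE x in \<alpha>. (\<lambda>i. Ln (1 + h i x)) \<longlonglongrightarrow> Ln (1 + (of_real c - \<i> * of_real (g x)))"
    proof (rule AE_I2)
      fix x
      have nz: "1 + (of_real c - \<i> * of_real (g x)) \<notin> \<real>\<^sub>\<le>\<^sub>0" using c by (intro one_plus_not_nonpos_Reals) simp
      have "(\<lambda>i. 1 + h i x) \<longlonglongrightarrow> 1 + (of_real c - \<i> * of_real (g x))"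
        unfolding h_def by (intro tendsto_intros f(2))
      from tendsto_Ln[OF this nz] show "(\<lambda>i. Ln (1 + h i x)) \<longlonglongrightarrow> Ln (1 + (of_real c - \<i> * of_real (g x)))" .
    qed
    show "AE x in \<alpha>. norm (Ln (1 + h i x)) \<le> (ln (1 + c) + ln 2 + ln (1 + \<bar>g x\<bar>)) + pi" for i
    proof (rule AE_I2)
      fix x
      have "norm (h i x) \<le> norm (complex_of_real c) + norm (\<i> * of_real (f i x))"
        unfolding h_def by (rule norm_triangle_ineq4)
      then have n: "norm (h i x) \<le> c + 2 * \<bar>g x\<bar>" using f(3)[of i x] c by (simp add: norm_mult)
      have "norm (Ln (1 + h i x)) \<le> ln (1 + norm (h i x)) + pi"
        using hRe c by (intro norm_Ln_one_plus_le) simp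
      also have "ln (1 + norm (h i x)) \<le> ln ((1 + c) * (2 * (1 + \<bar>g x\<bar>)))"
      proof (rule ln_mono)
        have "0 \<le> c * (2 * \<bar>g x\<bar>)" using c by simp
        moreover have "(1 + c) * (2 * (1 + \<bar>g x\<bar>)) = 2 + 2 * \<bar>g x\<bar> + 2 * c + c * (2 * \<bar>g x\<bar>)"
          by (simp add: algebra_simps)
        ultimately show "1 + norm (h i x) \<le> (1 + c) * (2 * (1 + \<bar>g x\<bar>))" using n c by linarith
      qed (simp add: add_pos_nonneg)
      also have "\<dots> = ln (1 + c) + ln 2 + ln (1 + \<bar>g x\<bar>)"
      proof -
        have "0 < 1 + c" "0 < 1 + \<bar>g x\<bar>" using c by linarith+
        then show ?thesis by (simp add: ln_mult del: distrib_left_numeral)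
      qed
      finally show "norm (Ln (1 + h i x)) \<le> (ln (1 + c) + ln 2 + ln (1 + \<bar>g x\<bar>)) + pi" by simp
    qed
  qed
  ultimately show ?thesis unfolding eq by (rule LIMSEQ_unique)
qed

section \<open>Characteristic functions of products of independent variables\<close>

lemma (in prob_space) indep_var_functions:
  assumes ind: "indep_vars (\<lambda>_. borel) X I" and AB: "A \<inter> B = {}" "A \<subseteq> I" "B \<subseteq> I"
    and F: "F \<in> borel_measurable (PiM A (\<lambda>_. borel))" and G: "G \<in> borel_measurable (PiM B (\<lambda>_. borel))"
  shows "indep_var borel (\<lambda>w. F (\<lambda>i\<in>A. X i w)) borel (\<lambda>w. G (\<lambda>i\<in>B. X i w))"
  using indep_var_compose[OF indep_var_restrict[OF ind AB] F G] by (simp add: comp_def)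

text \<open>
  Independence of generated sigma-algebras passes to real variables measurable with respect to
  them, which brings the variables to a common value type.
\<close>

lemma (in prob_space) indep_vars_of_indep_events_of:
  fixes X :: "nat \<Rightarrow> 'a \<Rightarrow> real"
  assumes ind: "indep_events_of M Es"
    and X: "\<And>i. i < length Es \<Longrightarrow> X i \<in> borel_measurable M"
    and sub: "\<And>i. i < length Es \<Longrightarrow> events_of M borel (X i) \<subseteq> Es ! i"
  shows "indep_vars (\<lambda>_. borel) X {..<length Es}"
  unfolding indep_vars_def2
proof (intro conjI ballI)
  show "indep_sets (\<lambda>i. {X i -` A \<inter> space M |A. A \<in> sets borel}) {..<length Es}"
    using ind unfolding indep_events_of_def by (rule indep_sets_mono_sets) (use sub in \<open>auto simp: events_of_def\<close>)
qed (use X in auto)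

lemma events_of_comp_subset:
  assumes "X \<in> measurable P N" "f \<in> measurable N N'"
  shows "events_of P N' (\<lambda>w. f (X w)) \<subseteq> events_of P N X"
proof
  fix E assume "E \<in> events_of P N' (\<lambda>w. f (X w))"
  then obtain A where A: "A \<in> sets N'" "E = (\<lambda>w. f (X w)) -` A \<inter> space P" by (auto simp: events_of_def)
  have "E = X -` (f -` A \<inter> space N) \<inter> space P"
    using measurable_space[OF assms(1)] A by auto
  moreover have "f -` A \<inter> space N \<in> sets N" using assms A by (auto intro: measurable_sets)
  ultimately show "E \<in> events_of P N X" unfolding events_of_def by blast
qed

lemma (in prob_space) char_distr_mult:
  fixes X Z :: "'a \<Rightarrow> real"
  assumes ind: "indep_var borel X borel Z"
  shows "char (distr M borel (\<lambda>w. X w * Z w)) s = (\<integral>u. char (distr M borel Z) (s * u) \<partial>distr M borel X)"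
proof -
  have [measurable]: "X \<in> borel_measurable M" "Z \<in> borel_measurable M"
    using ind by (auto dest: indep_var_rv1 indep_var_rv2)
  interpret X: prob_space "distr M borel X" by (rule prob_space_distr) simp
  interpret Z: prob_space "distr M borel Z" by (rule prob_space_distr) simp
  interpret XZ: pair_prob_space "distr M borel X" "distr M borel Z" ..
  have eq: "distr M borel X \<Otimes>\<^sub>M distr M borel Z = distr M (borel \<Otimes>\<^sub>M borel) (\<lambda>x. (X x, Z x))"
    using ind by (simp add: indep_var_distribution_eq)
  have "char (distr M borel (\<lambda>w. X w * Z w)) s = (\<integral>w. iexp (s * (X w * Z w)) \<partial>M)"
    by (simp add: char_def integral_distr)
  also have "\<dots> = (\<integral>p. iexp (s * (fst p * snd p)) \<partial>distr M (borel \<Otimes>\<^sub>M borel) (\<lambda>x. (X x, Z x)))"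
    by (subst integral_distr) auto
  also have "\<dots> = (\<integral>p. (case p of (x, z) \<Rightarrow> iexp (s * (x * z))) \<partial>(distr M borel X \<Otimes>\<^sub>M distr M borel Z))"
    unfolding eq by (simp add: split_beta)
  also have "\<dots> = (\<integral>x. \<integral>z. iexp (s * (x * z)) \<partial>distr M borel Z \<partial>distr M borel X)"
    by (rule XZ.integral_fst[symmetric]) (auto intro!: XZ.integrable_const_bound[of _ 1] simp: split_beta)
  also have "\<dots> = (\<integral>u. char (distr M borel Z) (s * u) \<partial>distr M borel X)"
    by (simp add: char_def mult.assoc)
  finally show ?thesis .
qed

lemma distr_borel_density:
  assumes "distributed P lborel X f"
  shows "distr P borel X = density lborel f"
proof -
  have "distr P borel X = distr P lborel X" by (rule distr_cong) auto
  then show ?thesis using assms by (simp add: distributed_distr_eq_density)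
qed

lemma char_exponential:
  assumes "distributed P lborel T (\<lambda>x. ennreal (gamma_density 1 x))"
  shows "char (distr P borel T) t = 1 / (1 - \<i> * of_real t)"
proof -
  have nz: "1 + - (\<i> * of_real t) \<noteq> 0" using one_plus_not_nonpos_Reals[of "- (\<i> * of_real t)"] by auto
  have "char (distr P borel T) t = (\<integral>x. gamma_density 1 x *\<^sub>R iexp (t * x) \<partial>lborel)"
    unfolding char_def distr_borel_density[OF assms] by (rule integral_density) (auto simp: gamma_density_nonneg)
  also have "\<dots> = (\<integral>x. of_real (gamma_density 1 x) * exp (- (- (\<i> * of_real t) * of_real x)) \<partial>lborel)"
    by (simp add: scaleR_conv_of_real mult.assoc)
  also have "\<dots> = exp (- (of_real 1 * Ln (1 + - (\<i> * of_real t))))"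
    by (rule gamma_complex_laplace) auto
  finally show ?thesis using nz by (simp add: exp_minus divide_inverse)
qed

text \<open>
  Conditioning on \<open>U\<close> splits the sum into the independent parts \<open>\<mu>(g)\<close> and \<open>T g(Y)\<close>; conditioning the
  latter on \<open>Y\<close> leaves the characteristic function \<open>1 / (1 - i t)\<close> of the exponential variable \<open>T\<close>.
\<close>

lemma (in prob_space) char_perturbed:
  fixes g :: "'b::polish_space \<Rightarrow> real"
  assumes mu [measurable]: "\<mu> \<in> measurable M bf_measures" and U [measurable]: "U \<in> borel_measurable M"
    and T: "distributed M lborel T (\<lambda>x. ennreal (gamma_density 1 x))"
    and Y [measurable]: "Y \<in> borel_measurable M" and g [measurable]: "g \<in> borel_measurable borel"
    and ind: "indep_events_of M [events_of M bf_measures \<mu>, events_of M borel U, events_of M borel T, events_of M borel Y]"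
  shows "char (distr M borel (\<lambda>w. U w * (\<integral>y. g y \<partial>\<mu> w) + U w * T w * g (Y w))) s =
    (\<integral>u. char (distr M borel (\<lambda>w. \<integral>y. g y \<partial>\<mu> w)) (s * u) *
         (\<integral>y. 1 / (1 - \<i> * of_real (s * u * g y)) \<partial>distr M borel Y) \<partial>distr M borel U)"
proof -
  have Tm [measurable]: "T \<in> borel_measurable M" using distributed_measurable[OF T] by simp
  define X where "X i = [\<lambda>w. \<integral>y. g y \<partial>\<mu> w, U, T, \<lambda>w. g (Y w)] ! i" for i
  have X [simp]: "X 0 = (\<lambda>w. \<integral>y. g y \<partial>\<mu> w)" "X (Suc 0) = U" "X 2 = T" "X 3 = (\<lambda>w. g (Y w))"
    by (simp_all add: X_def)
  let ?Es = "[events_of M bf_measures \<mu>, events_of M borel U, events_of M borel T, events_of M borel Y]"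
  have gm [measurable]: "(\<lambda>w. \<integral>y. g y \<partial>\<mu> w) \<in> borel_measurable M"
    using measurable_compose[OF mu integral_measurable_bf_measures[OF g]] .
  have lt4: "i < length ?Es \<Longrightarrow> i = 0 \<or> i = Suc 0 \<or> i = 2 \<or> i = 3" for i by auto
  have "indep_vars (\<lambda>_. borel) X {..<length ?Es}"
  proof (rule indep_vars_of_indep_events_of[OF ind])
    show "X i \<in> borel_measurable M" if "i < length ?Es" for i
      using lt4[OF that] by auto
    show "events_of M borel (X i) \<subseteq> ?Es ! i" if "i < length ?Es" for i
      using lt4[OF that] events_of_comp_subset[OF mu integral_measurable_bf_measures[OF g]]
        events_of_comp_subset[OF Y g] by auto
  qed
  then have iv: "indep_vars (\<lambda>_. borel) X {0, 1, 2, 3}"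
    by (rule indep_vars_subset) auto
  have i1: "indep_var borel U borel (\<lambda>w. (\<integral>y. g y \<partial>\<mu> w) + T w * g (Y w))"
    using indep_var_functions[OF iv, of "{1}" "{0, 2, 3}" "\<lambda>f. f 1" "\<lambda>f. f 0 + f 2 * f 3"] by simp
  have i2: "indep_var borel (\<lambda>w. \<integral>y. g y \<partial>\<mu> w) borel (\<lambda>w. T w * g (Y w))"
    using indep_var_functions[OF iv, of "{0}" "{2, 3}" "\<lambda>f. f 0" "\<lambda>f. f 2 * f 3"] by simp
  have i3: "indep_var borel (\<lambda>w. g (Y w)) borel T"
    using indep_var_functions[OF iv, of "{3}" "{2}" "\<lambda>f. f 3" "\<lambda>f. f 2"] by simp
  have c3: "char (distr M borel (\<lambda>w. T w * g (Y w))) t = (\<integral>y. 1 / (1 - \<i> * of_real (t * g y)) \<partial>distr M borel Y)" for t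
  proof -
    have "char (distr M borel (\<lambda>w. T w * g (Y w))) t = (\<integral>h. char (distr M borel T) (t * h) \<partial>distr M borel (\<lambda>w. g (Y w)))"
      using char_distr_mult[OF i3] by (simp add: mult.commute)
    also have "\<dots> = (\<integral>h. 1 / (1 - \<i> * of_real (t * h)) \<partial>distr M borel (\<lambda>w. g (Y w)))"
      unfolding char_exponential[OF T] ..
    also have "distr M borel (\<lambda>w. g (Y w)) = distr (distr M borel Y) borel g"
      by (subst distr_distr) (auto simp: comp_def)
    also have "(\<integral>h. 1 / (1 - \<i> * of_real (t * h)) \<partial>distr (distr M borel Y) borel g) = (\<integral>y. 1 / (1 - \<i> * of_real (t * g y)) \<partial>distr M borel Y)"
      by (subst integral_distr) auto
    finally show ?thesis .
  qed
  have "(\<lambda>w. U w * (\<integral>y. g y \<partial>\<mu> w) + U w * T w * g (Y w)) = (\<lambda>w. U w * ((\<integral>y. g y \<partial>\<mu> w) + T w * g (Y w)))"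
    by (simp add: algebra_simps)
  then show ?thesis
    by (simp only: char_distr_mult[OF i1] char_distr_add[OF i2] c3)
qed

section \<open>The differential equation and its beta integrals\<close>

lemma FTC_unit_interval:
  fixes F f :: "real \<Rightarrow> complex"
  assumes F: "\<And>x. 0 < x \<Longrightarrow> x < 1 \<Longrightarrow> (F has_vector_derivative f x) (at x)"
    and f: "\<And>x. 0 < x \<Longrightarrow> x < 1 \<Longrightarrow> isCont f x"
    and int: "integrable lborel (\<lambda>x. indicator {0<..<1} x *\<^sub>R f x)"
    and A: "(F \<longlongrightarrow> A) (at_right 0)" and B: "(F \<longlongrightarrow> B) (at_left 1)"
  shows "(\<integral>x. indicator {0<..<1} x *\<^sub>R f x \<partial>lborel) = B - A"
proof -
  have e: "einterval (ereal 0) (ereal 1) = {0<..<1}" by (auto simp: einterval_def)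
  have "(LBINT x=ereal 0..ereal 1. f x) = B - A"
  proof (rule interval_integral_FTC_integrable)
    show "set_integrable lborel (einterval (ereal 0) (ereal 1)) f"
      unfolding e set_integrable_def by (rule int)
    show "((F \<circ> real_of_ereal) \<longlongrightarrow> A) (at_right (ereal 0))" "((F \<circ> real_of_ereal) \<longlongrightarrow> B) (at_left (ereal 1))"
      using A B by (simp_all only: ereal_tendsto_simps)
  qed (use F f in auto)
  then show ?thesis
    unfolding interval_lebesgue_integral_def e set_lebesgue_integral_def by simp
qed

lemma measurable_beta_density [measurable]: "beta_density a b \<in> borel_measurable borel"
  unfolding beta_density_def by measurable

lemma integrable_beta_density:
  assumes "0 < a" "0 < b" shows "integrable lborel (beta_density a b)"
proof -
  have I: "integrable lborel (\<lambda>t. indicator {0..1} t *\<^sub>R (t powr (a - 1) * (1 - t) powr (b - 1)) :: real)"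
    using integrable_Beta[OF assms] by (simp only: set_integrable_def)
  have "integrable lborel (\<lambda>t. indicator {0<..<1} t *\<^sub>R (indicator {0..1} t *\<^sub>R (t powr (a - 1) * (1 - t) powr (b - 1))) :: real)"
    by (rule integrable_mult_indicator[OF _ I]) simp
  then have "integrable lborel (\<lambda>t. (indicator {0<..<1} t *\<^sub>R (indicator {0..1} t *\<^sub>R (t powr (a - 1) * (1 - t) powr (b - 1)))) / Beta a b)"
    by (rule integrable_divide)
  then show ?thesis
    by (rule Bochner_Integration.integrable_cong[OF refl, THEN iffD1, rotated]) (auto simp: beta_density_def indicator_def)
qed

lemma Beta_1_left: assumes "0 < (b::real)" shows "Beta 1 b = 1 / b"
proof -
  have "Gamma (1 + b) = b * Gamma b"
    using assms by (subst add.commute, intro Gamma_plus1) (auto elim!: nonpos_Ints_cases)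
  then show ?thesis using Gamma_real_pos[OF assms] by (simp add: Beta_def)
qed

lemma beta_density_1_left: "0 < b \<Longrightarrow> beta_density 1 b u = indicator {0<..<1} u * (b * (1 - u) powr (b - 1))"
  by (auto simp: beta_density_def Beta_1_left indicator_def)

lemma beta_density_1_right: "0 < a \<Longrightarrow> beta_density a 1 u = indicator {0<..<1} u * (a * u powr (a - 1))"
  using Beta_commute[of a 1] by (auto simp: beta_density_def Beta_1_left indicator_def)

lemma integrable_beta_density_mult:
  fixes h :: "real \<Rightarrow> complex"
  assumes "0 < a" "0 < b" and [measurable]: "h \<in> borel_measurable borel" and h: "\<And>u. norm (h u) \<le> 1"
  shows "integrable lborel (\<lambda>u. beta_density a b u *\<^sub>R h u)"
proof (rule Bochner_Integration.integrable_bound[OF integrable_beta_density[OF assms(1,2)]])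
  show "AE u in lborel. norm (beta_density a b u *\<^sub>R h u) \<le> norm (beta_density a b u)"
    using h by (intro AE_I2) (simp add: mult_left_le)
qed measurable

text \<open>
  What the beta identities draw from the gamma process: the differential equation for \<open>\<Lambda>\<close>, and
  continuity and uniform bounds, which make the integrals over the unit interval converge.
\<close>

locale beta_gamma_ode =
  fixes \<theta> :: real and \<Lambda> \<Psi> :: "real \<Rightarrow> complex"
  assumes \<theta>: "0 < \<theta>"
    and \<Lambda>_bound: "\<And>u. norm (\<Lambda> u) \<le> 1" and \<Psi>_bound: "\<And>u. norm (\<Psi> u) \<le> 1"
    and \<Lambda>_cont: "\<And>u. isCont \<Lambda> u" and \<Psi>_cont: "\<And>u. isCont \<Psi> u"
    and ode: "\<And>u. 0 < u \<Longrightarrow> (\<Lambda> has_vector_derivative of_real (\<theta> / u) * \<Lambda> u * (\<Psi> u - 1)) (at u)"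
begin

lemma measurable_solution [measurable]: "\<Lambda> \<in> borel_measurable borel" "\<Psi> \<in> borel_measurable borel"
  using \<Lambda>_cont \<Psi>_cont by (auto intro!: borel_measurable_continuous_onI continuous_at_imp_continuous_on)

lemma product_bound: "norm (\<Lambda> u * \<Psi> u) \<le> 1"
  using \<Lambda>_bound[of u] \<Psi>_bound[of u] by (simp add: norm_mult mult_le_one)

lemma powr_solution_derivative:
  assumes u: "0 < u"
  shows "((\<lambda>u. of_real (u powr \<theta>) * \<Lambda> u) has_vector_derivative of_real (\<theta> * u powr (\<theta> - 1)) * (\<Lambda> u * \<Psi> u)) (at u)"
proof -
  have "((\<lambda>u. u powr \<theta>) has_real_derivative \<theta> * u powr (\<theta> - 1)) (at u)"
    using u by (auto intro!: derivative_eq_intros)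
  then have d: "((\<lambda>u. of_real (u powr \<theta>)) has_vector_derivative complex_of_real (\<theta> * u powr (\<theta> - 1))) (at u)"
    by (intro has_vector_derivative_of_real) (simp add: has_real_derivative_iff_has_vector_derivative)
  have p: "u powr \<theta> * (\<theta> / u) = \<theta> * u powr (\<theta> - 1)" using u by (simp add: powr_diff)
  have "of_real (u powr \<theta>) * (of_real (\<theta> / u) * \<Lambda> u * (\<Psi> u - 1)) = of_real (u powr \<theta> * (\<theta> / u)) * (\<Lambda> u * (\<Psi> u - 1))"
    by (simp only: of_real_mult mult.assoc)
  then have "of_real (u powr \<theta>) * (of_real (\<theta> / u) * \<Lambda> u * (\<Psi> u - 1)) = of_real (\<theta> * u powr (\<theta> - 1)) * (\<Lambda> u * (\<Psi> u - 1))"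
    unfolding p .
  with has_vector_derivative_mult[OF d ode[OF u]] show ?thesis
    by (simp add: algebra_simps)
qed

text \<open>
  The integrand is the derivative of \<open>u powr \<theta> \<Lambda>(u)\<close>, which vanishes at 0 and equals \<open>\<Lambda>(1)\<close> at 1.
\<close>

lemma beta_identity_fixed_point:
  "(\<integral>u. beta_density \<theta> 1 u *\<^sub>R (\<Lambda> u * \<Psi> u) \<partial>lborel) = \<Lambda> 1"
proof -
  let ?F = "\<lambda>u. of_real (u powr \<theta>) * \<Lambda> u"
  let ?f = "\<lambda>u. of_real (\<theta> * u powr (\<theta> - 1)) * (\<Lambda> u * \<Psi> u)"
  have eq: "beta_density \<theta> 1 u *\<^sub>R (\<Lambda> u * \<Psi> u) = indicator {0<..<1} u *\<^sub>R ?f u" for u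
    using \<theta> by (simp add: beta_density_1_right scaleR_conv_of_real mult.assoc)
  have "(\<integral>u. indicator {0<..<1} u *\<^sub>R ?f u \<partial>lborel) = \<Lambda> 1 - 0"
  proof (rule FTC_unit_interval)
    show "(?F has_vector_derivative ?f u) (at u)" if "0 < u" "u < 1" for u
      using that by (intro powr_solution_derivative)
    show "isCont ?f u" if "0 < u" "u < 1" for u
      using that by (intro continuous_intros \<Lambda>_cont \<Psi>_cont) auto
    show "integrable lborel (\<lambda>u. indicator {0<..<1} u *\<^sub>R ?f u)"
      using integrable_beta_density_mult[of \<theta> 1 "\<lambda>u. \<Lambda> u * \<Psi> u"] \<theta> product_bound by (simp add: eq)
    have "((\<lambda>u. u powr \<theta>) \<longlongrightarrow> 0) (at_right 0)" using \<theta> by real_asymp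
    then show "(?F \<longlongrightarrow> 0) (at_right 0)"
      by (rule Lim_null_comparison[rotated]) (use \<Lambda>_bound in \<open>auto simp: norm_mult intro!: always_eventually mult_left_le\<close>)
    have "isCont ?F 1" by (intro continuous_intros \<Lambda>_cont) auto
    then have "(?F \<longlongrightarrow> ?F 1) (at_left 1)" by (auto simp: isCont_def intro: tendsto_within_subset)
    then show "(?F \<longlongrightarrow> \<Lambda> 1) (at_left 1)" by simp
  qed
  then show ?thesis by (simp add: eq)
qed

text \<open>
  The difference of the two integrands is the derivative of \<open>u (1 - u) powr (\<theta> - 1) \<Lambda>(u)\<close>. This
  function vanishes at 1 because \<open>\<theta> > 1\<close>.
\<close>

lemma beta_identity_shape_shift:
  assumes \<theta>1: "1 < \<theta>"
  shows "(\<integral>u. beta_density 1 (\<theta> - 1) u *\<^sub>R \<Lambda> u \<partial>lborel) = (\<integral>u. beta_density 1 \<theta> u *\<^sub>R (\<Lambda> u * \<Psi> u) \<partial>lborel)"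
proof -
  let ?w = "\<lambda>u. u * (1 - u) powr (\<theta> - 1)"
  let ?F = "\<lambda>u. of_real (?w u) * \<Lambda> u"
  let ?f = "\<lambda>u. of_real (\<theta> * (1 - u) powr (\<theta> - 1)) * (\<Lambda> u * \<Psi> u) - of_real ((\<theta> - 1) * (1 - u) powr (\<theta> - 2)) * \<Lambda> u"
  have eq: "beta_density 1 \<theta> u *\<^sub>R (\<Lambda> u * \<Psi> u) - beta_density 1 (\<theta> - 1) u *\<^sub>R \<Lambda> u = indicator {0<..<1} u *\<^sub>R ?f u" for u
  proof -
    have "\<theta> - 1 - 1 = \<theta> - 2" by simp
    with \<theta> \<theta>1 show ?thesis
      by (simp only: beta_density_1_left diff_gt_0_iff_gt) (simp add: scaleR_conv_of_real algebra_simps)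
  qed
  have i1: "integrable lborel (\<lambda>u. beta_density 1 \<theta> u *\<^sub>R (\<Lambda> u * \<Psi> u))"
    using \<theta> product_bound by (intro integrable_beta_density_mult) auto
  have i2: "integrable lborel (\<lambda>u. beta_density 1 (\<theta> - 1) u *\<^sub>R \<Lambda> u)"
    using \<theta>1 \<Lambda>_bound by (intro integrable_beta_density_mult) auto
  have "(\<integral>u. indicator {0<..<1} u *\<^sub>R ?f u \<partial>lborel) = 0 - 0"
  proof (rule FTC_unit_interval)
    show "(?F has_vector_derivative ?f u) (at u)" if u: "0 < u" "u < 1" for u
    proof -
      have "(?w has_real_derivative (1 - u) powr (\<theta> - 1) - u * ((\<theta> - 1) * (1 - u) powr (\<theta> - 1 - 1))) (at u)"
        using u by (auto intro!: derivative_eq_intros)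
      then have d: "((\<lambda>u. complex_of_real (?w u)) has_vector_derivative complex_of_real ((1 - u) powr (\<theta> - 1) - u * ((\<theta> - 1) * (1 - u) powr (\<theta> - 2)))) (at u)"
        by (intro has_vector_derivative_of_real) (simp add: has_real_derivative_iff_has_vector_derivative)
      define a b where "a = (1 - u) powr (\<theta> - 1)" and "b = (\<theta> - 1) * (1 - u) powr (\<theta> - 2)"
      have ab: "(\<theta> - 1) * a = (1 - u) * b"
        using u by (simp add: a_def b_def powr_mult_base mult.left_commute[of "1 - u"])
      have "of_real (u * a) * (of_real (\<theta> / u) * \<Lambda> u * (\<Psi> u - 1)) + of_real (a - u * b) * \<Lambda> u
         = of_real (\<theta> * a) * (\<Lambda> u * \<Psi> u) - of_real ((\<theta> - 1) * a + u * b) * \<Lambda> u"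
        using u by (simp add: field_simps)
      also have "(\<theta> - 1) * a + u * b = b" unfolding ab by (simp add: algebra_simps)
      finally show ?thesis
        using has_vector_derivative_mult[OF d ode[OF u(1)]] unfolding a_def b_def by simp
    qed
    show "isCont ?f u" if "0 < u" "u < 1" for u
      using that by (intro continuous_intros \<Lambda>_cont \<Psi>_cont) auto
    show "integrable lborel (\<lambda>u. indicator {0<..<1} u *\<^sub>R ?f u)"
      using Bochner_Integration.integrable_diff[OF i1 i2] by (simp only: eq)
    have "(?w \<longlongrightarrow> 0) (at_right 0)" by real_asymp
    moreover have "\<forall>\<^sub>F u in at_right 0. norm (?F u) \<le> ?w u"
      using \<Lambda>_bound by (auto simp: eventually_at_filter norm_mult abs_mult intro!: always_eventually mult_left_le)
    ultimately show "(?F \<longlongrightarrow> 0) (at_right 0)" by (rule Lim_null_comparison[rotated])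
    have "((\<lambda>u. \<bar>?w u\<bar>) \<longlongrightarrow> 0) (at_left 1)" using \<theta>1 by real_asymp
    then show "(?F \<longlongrightarrow> 0) (at_left 1)"
      by (rule Lim_null_comparison[rotated])
         (use \<Lambda>_bound in \<open>auto simp: norm_mult abs_mult intro!: always_eventually mult_left_le\<close>)
  qed
  then have "(\<integral>u. beta_density 1 \<theta> u *\<^sub>R (\<Lambda> u * \<Psi> u) - beta_density 1 (\<theta> - 1) u *\<^sub>R \<Lambda> u \<partial>lborel) = 0"
    by (simp only: eq diff_self)
  then show ?thesis
    using Bochner_Integration.integral_diff[OF i1 i2] by simp
qed

end

section \<open>The characteristic function of a gamma process integral\<close>

lemma nn_integral_log_scale:
  fixes g :: "'a::polish_space \<Rightarrow> real"
  assumes \<alpha>: "finite_measure \<alpha>" "sets \<alpha> = sets borel" and g [measurable]: "g \<in> borel_measurable borel"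
    and fin: "(\<integral>\<^sup>+x. ennreal (ln (1 + \<bar>g x\<bar>)) \<partial>\<alpha>) < \<infinity>"
  shows "(\<integral>\<^sup>+x. ennreal (ln (1 + \<bar>t * g x\<bar>)) \<partial>\<alpha>) < \<infinity>"
proof -
  interpret finite_measure \<alpha> by fact
  note [measurable_cong] = \<alpha>(2)
  have "(\<integral>\<^sup>+x. ennreal (ln (1 + \<bar>t * g x\<bar>)) \<partial>\<alpha>) \<le> (\<integral>\<^sup>+x. ennreal (ln (1 + \<bar>t\<bar>)) + ennreal (ln (1 + \<bar>g x\<bar>)) \<partial>\<alpha>)"
  proof (rule nn_integral_mono)
    fix x
    have p: "0 < 1 + \<bar>t\<bar>" "0 < 1 + \<bar>g x\<bar>" by linarith+
    have "1 + \<bar>t * g x\<bar> \<le> (1 + \<bar>t\<bar>) * (1 + \<bar>g x\<bar>)" by (simp add: algebra_simps abs_mult)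
    moreover have "0 < 1 + \<bar>t * g x\<bar>" by linarith
    ultimately have "ln (1 + \<bar>t * g x\<bar>) \<le> ln ((1 + \<bar>t\<bar>) * (1 + \<bar>g x\<bar>))" by (intro ln_mono)
    also have "\<dots> = ln (1 + \<bar>t\<bar>) + ln (1 + \<bar>g x\<bar>)" using p by (simp add: ln_mult)
    finally show "ennreal (ln (1 + \<bar>t * g x\<bar>)) \<le> ennreal (ln (1 + \<bar>t\<bar>)) + ennreal (ln (1 + \<bar>g x\<bar>))"
      by (simp add: ennreal_plus[symmetric] del: ennreal_plus)
  qed
  also have "\<dots> = ennreal (ln (1 + \<bar>t\<bar>)) * emeasure \<alpha> (space \<alpha>) + (\<integral>\<^sup>+x. ennreal (ln (1 + \<bar>g x\<bar>)) \<partial>\<alpha>)"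
    by (subst nn_integral_add) auto
  also have "\<dots> < \<infinity>" using fin emeasure_finite[of "space \<alpha>", unfolded less_top] by (simp add: ennreal_mult_less_top)
  finally show ?thesis .
qed

lemma norm_inverse_le_1: "norm (1 / (1 - \<i> * complex_of_real r)) \<le> 1"
proof -
  have "1 \<le> norm (1 - \<i> * complex_of_real r)"
    using complex_Re_le_cmod[of "1 - \<i> * complex_of_real r"] by simp
  then show ?thesis by (simp add: norm_divide divide_le_eq_1)
qed

locale gamma_process_integrand =
  fixes P :: "'w measure" and \<alpha> :: "'a::polish_space measure" and \<mu> :: "'w \<Rightarrow> 'a measure"
    and g :: "'a \<Rightarrow> real" and \<theta> :: real
  assumes gp: "gamma_process P \<alpha> \<mu>" and fin: "finite_measure \<alpha>" and sets: "sets \<alpha> = sets borel"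
    and total: "measure \<alpha> UNIV = \<theta>" and \<theta>: "0 < \<theta>"
    and g: "g \<in> borel_measurable borel"
    and log: "(\<integral>\<^sup>+x. ennreal (ln (1 + \<bar>g x\<bar>)) \<partial>\<alpha>) < \<infinity>"
begin

sublocale P: prob_space P using gp by (simp add: gamma_process_def)
sublocale \<alpha>: finite_measure \<alpha> by (rule fin)

declare g [measurable]

lemma mu [measurable]: "\<mu> \<in> measurable P bf_measures"
  using gp by (simp add: gamma_process_def)

lemma space_shape: "space \<alpha> = UNIV"
  using sets_eq_imp_space_eq[OF sets] by simp

definition X :: "'w \<Rightarrow> real" where "X w = (\<integral>x. g x \<partial>\<mu> w)"

definition mass :: "'w \<Rightarrow> real" where "mass w = measure (\<mu> w) UNIV"

lemma measurable_X [measurable]: "X \<in> borel_measurable P"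
  unfolding X_def using measurable_compose[OF mu integral_measurable_bf_measures[OF g]] .

lemma measurable_mass [measurable]: "mass \<in> borel_measurable P"
  unfolding mass_def using measurable_compose[OF mu measure_measurable_bf_measures[of UNIV]] by simp

lemma joint_transform:
  assumes c: "0 \<le> c"
  shows "(\<integral>w. exp (- of_real (c * mass w) + \<i> * of_real (t * X w)) \<partial>P) =
    exp (- (\<integral>x. Ln (1 + (of_real c - \<i> * of_real (t * g x))) \<partial>\<alpha>))"
  using gamma_process_functional[OF gp fin sets _ nn_integral_log_scale[OF fin sets g log, of t] c]
  by (simp add: X_def mass_def)

lemma integrable_Ln: "complex_integrable \<alpha> (\<lambda>x. Ln (1 - \<i> * of_real (t * g x)))"
proof -
  note [measurable_cong] = sets
  have i: "integrable \<alpha> (\<lambda>x. ln (1 + \<bar>t * g x\<bar>) + pi)"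
    using integrable_log_one_plus[OF sets _ nn_integral_log_scale[OF fin sets g log, of t]] by simp
  show ?thesis
  proof (rule Bochner_Integration.integrable_bound[OF i])
    show "(\<lambda>x. Ln (1 - \<i> * of_real (t * g x))) \<in> borel_measurable \<alpha>"
      using borel_measurable_Ln_one_plus[of "\<lambda>x. - (\<i> * of_real (t * g x))" \<alpha>] by simp
    show "AE x in \<alpha>. norm (Ln (1 - \<i> * of_real (t * g x))) \<le> norm (ln (1 + \<bar>t * g x\<bar>) + pi)"
    proof (rule AE_I2)
      fix x
      have "norm (Ln (1 + - (\<i> * of_real (t * g x)))) \<le> ln (1 + norm (- (\<i> * complex_of_real (t * g x)))) + pi"
        by (rule norm_Ln_one_plus_le) simp
      also have "norm (- (\<i> * complex_of_real (t * g x))) = \<bar>t * g x\<bar>" by (simp only: norm_minus_cancel norm_mult norm_ii norm_of_real mult_1)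
      finally have "norm (Ln (1 - \<i> * of_real (t * g x))) \<le> ln (1 + \<bar>t * g x\<bar>) + pi" by simp
      also have "\<dots> \<le> norm (ln (1 + \<bar>t * g x\<bar>) + pi)" by (simp only: real_norm_def abs_ge_self)
      finally show "norm (Ln (1 - \<i> * of_real (t * g x))) \<le> norm (ln (1 + \<bar>t * g x\<bar>) + pi)" .
    qed
  qed
qed

definition \<Lambda> :: "real \<Rightarrow> real \<Rightarrow> complex" where "\<Lambda> s u = char (distr P borel X) (s * u)"

text \<open>
  Divided by \<open>\<theta>\<close> because the shape measure has total mass \<open>\<theta>\<close>: this is the mean under the normalised
  shape measure.
\<close>

definition \<Psi> :: "real \<Rightarrow> real \<Rightarrow> complex" where
  "\<Psi> s u = (\<integral>x. 1 / (1 - \<i> * of_real (s * u * g x)) \<partial>\<alpha>) / of_real \<theta>"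

definition log_integral :: "real \<Rightarrow> real \<Rightarrow> complex" where
  "log_integral s u = (\<integral>x. Ln (1 - \<i> * of_real (s * u * g x)) \<partial>\<alpha>)"

lemma \<Lambda>_eq: "\<Lambda> s u = exp (- log_integral s u)"
proof -
  have "\<Lambda> s u = (\<integral>w. exp (- of_real (0 * mass w) + \<i> * of_real ((s * u) * X w)) \<partial>P)"
    by (simp add: \<Lambda>_def char_def integral_distr)
  then show ?thesis by (subst (asm) joint_transform) (simp_all add: log_integral_def)
qed

lemma integrable_kernel: "complex_integrable \<alpha> (\<lambda>x. 1 / (1 - \<i> * of_real (t * g x)))"
proof -
  note [measurable_cong] = sets
  show ?thesis by (rule \<alpha>.integrable_const_bound[of _ 1]) (rule AE_I2, rule norm_inverse_le_1, measurable)
qed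

text \<open>
  The derivative of the integrand, \<open>- i s g / (1 - i s u g)\<close>, equals \<open>(1 - 1 / (1 - i s u g)) / u\<close>. In
  this form it is bounded by \<open>2 / u\<close> whatever the size of \<open>g\<close>, and \<open>\<Psi>\<close> appears upon integration.
\<close>

lemma log_integral_derivative:
  assumes u: "0 < u"
  shows "(log_integral s has_vector_derivative of_real (\<theta> / u) * (1 - \<Psi> s u)) (at u)"
proof -
  note [measurable_cong] = sets
  let ?d = "\<lambda>u x. (1 - 1 / (1 - \<i> * of_real (s * u * g x))) / complex_of_real u"
  have "(log_integral s has_vector_derivative (\<integral>x. ?d u x \<partial>\<alpha>)) (at u)"
    unfolding log_integral_def
  proof (rule has_vector_derivative_integral_dominated[where a="u / 2" and b="u + 1" and B="\<lambda>_. 4 / u"])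
    fix t x assume t: "u / 2 < t" "t < u + 1"
    then have t0: "0 < t" using u by linarith
    have nz: "1 - \<i> * of_real (t * (s * g x)) \<notin> \<real>\<^sub>\<le>\<^sub>0"
      using one_plus_not_nonpos_Reals[of "- (\<i> * of_real (t * (s * g x)))"] by simp
    then have nz': "1 - \<i> * of_real (t * (s * g x)) \<noteq> 0" by auto
    have "((\<lambda>t. Ln (1 - \<i> * (of_real t * of_real (s * g x)))) has_vector_derivative
        (- \<i> * of_real (s * g x)) / (1 - \<i> * of_real (t * (s * g x)))) (at t)"
      by (rule has_vector_derivative_real_field[where f="\<lambda>z. Ln (1 - \<i> * (z * of_real (s * g x)))"])
         (use nz in \<open>auto intro!: derivative_eq_intros simp: field_simps\<close>)
    moreover have "(- \<i> * of_real (s * g x)) / (1 - \<i> * of_real (t * (s * g x))) = ?d t x"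
      using t0 nz' by (simp add: field_simps)
    ultimately show "((\<lambda>t. Ln (1 - \<i> * of_real (s * t * g x))) has_vector_derivative ?d t x) (at t)"
      by (simp add: mult_ac)
    have "norm (1 - 1 / (1 - \<i> * complex_of_real (s * t * g x))) \<le> norm (1::complex) + norm (1 / (1 - \<i> * complex_of_real (s * t * g x)))"
      by (rule norm_triangle_ineq4)
    also have "\<dots> \<le> 2" using norm_inverse_le_1[of "s * t * g x"] by simp
    finally have "norm (?d t x) \<le> 2 / t" using t0 by (simp add: norm_divide divide_right_mono)
    also have "\<dots> \<le> 4 / u" using t u t0 by (simp add: field_simps)
    finally show "norm (?d t x) \<le> 4 / u" .
  next
    show "complex_integrable \<alpha> (\<lambda>x. Ln (1 - \<i> * of_real (s * t * g x)))" for t by (rule integrable_Ln)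
  qed (use u in auto)
  also have "(\<integral>x. ?d u x \<partial>\<alpha>) = (of_real \<theta> - of_real \<theta> * \<Psi> s u) / of_real u"
    using integrable_kernel[of "s * u"] \<theta> total
    by (subst integral_divide_zero, subst Bochner_Integration.integral_diff)
       (auto simp: \<Psi>_def space_shape scaleR_conv_of_real)
  also have "\<dots> = of_real (\<theta> / u) * (1 - \<Psi> s u)"
    by (simp add: field_simps)
  finally show ?thesis .
qed

sublocale ode: beta_gamma_ode \<theta> "\<Lambda> s" "\<Psi> s" for s
proof
  interpret X: real_distribution "distr P borel X" by (rule P.real_distribution_distr) simp
  note [measurable_cong] = sets
  show "0 < \<theta>" by (rule \<theta>)
  show "norm (\<Lambda> s u) \<le> 1" for u unfolding \<Lambda>_def by (rule X.cmod_char_le_1)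
  show "isCont (\<Lambda> s) u" for u
    unfolding \<Lambda>_def using isCont_o2[OF _ X.isCont_char, of u "\<lambda>u. s * u"] by simp
  show "norm (\<Psi> s u) \<le> 1" for u
  proof -
    have "norm (\<integral>x. 1 / (1 - \<i> * complex_of_real (s * u * g x)) \<partial>\<alpha>) \<le> (\<integral>x. norm (1 / (1 - \<i> * complex_of_real (s * u * g x))) \<partial>\<alpha>)"
      by (rule integral_norm_bound)
    also have "\<dots> \<le> (\<integral>x. 1 \<partial>\<alpha>)"
      by (rule integral_mono[OF integrable_norm[OF integrable_kernel]]) (simp, rule norm_inverse_le_1)
    finally have "norm (\<integral>x. 1 / (1 - \<i> * complex_of_real (s * u * g x)) \<partial>\<alpha>) \<le> (\<integral>x. 1 \<partial>\<alpha>)" .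
    then show ?thesis using \<theta> total by (simp add: \<Psi>_def norm_divide space_shape divide_le_eq_1)
  qed
  show "isCont (\<Psi> s) u" for u
    unfolding continuous_at_sequentially
  proof safe
    fix U assume U: "U \<longlonglongrightarrow> u"
    have nz: "1 - \<i> * complex_of_real r \<noteq> 0" for r
      using one_plus_not_nonpos_Reals[of "- (\<i> * of_real r)"] by auto
    show "(\<Psi> s \<circ> U) \<longlonglongrightarrow> \<Psi> s u"
      unfolding comp_def \<Psi>_def
    proof (intro tendsto_divide integral_dominated_convergence[where w="\<lambda>_. 1"])
      show "AE x in \<alpha>. (\<lambda>n. 1 / (1 - \<i> * complex_of_real (s * U n * g x))) \<longlonglongrightarrow> 1 / (1 - \<i> * complex_of_real (s * u * g x))"
        by (intro AE_I2 tendsto_intros U nz)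
      show "AE x in \<alpha>. norm (1 / (1 - \<i> * complex_of_real (s * U n * g x))) \<le> 1" for n
        by (intro AE_I2 norm_inverse_le_1)
    qed (use \<theta> in auto)
  qed
  show "(\<Lambda> s has_vector_derivative of_real (\<theta> / u) * \<Lambda> s u * (\<Psi> s u - 1)) (at u)" if u: "0 < u" for u
  proof -
    have "((\<lambda>z. exp (- z)) has_field_derivative - exp (- log_integral s u)) (at (log_integral s u))"
      by (auto intro!: derivative_eq_intros)
    from field_vector_diff_chain_at[OF log_integral_derivative[OF u] this]
    have "(\<Lambda> s has_vector_derivative of_real (\<theta> / u) * (1 - \<Psi> s u) * - \<Lambda> s u) (at u)"
      unfolding comp_def \<Lambda>_eq[symmetric] .
    also have "of_real (\<theta> / u) * (1 - \<Psi> s u) * - \<Lambda> s u = of_real (\<theta> / u) * \<Lambda> s u * (\<Psi> s u - 1)"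
      by (simp add: ring_distribs del: of_real_divide)
    finally show ?thesis .
  qed
qed

end

section \<open>Powers of the total mass\<close>

text \<open>
  In the variable \<open>v = 1 - u\<close>, the mixture of the functions \<open>t exp (- t (1 - u) / u)\<close> that
  represents \<open>\<Gamma>(\<theta>) t powr (1 - \<theta>)\<close>. The variable \<open>v\<close> is chosen so that the substitution
  \<open>v = x / (t + x)\<close> from the gamma integral is increasing.
\<close>

definition mass_kernel :: "real \<Rightarrow> real \<Rightarrow> real \<Rightarrow> real" where
  "mass_kernel \<theta> t v = indicator {0<..<1} v *
     (v powr (\<theta> - 1) * (1 - v) powr (- \<theta> - 1) * (t * exp (- (t * (v / (1 - v))))))"

lemma mass_kernel_nonneg: "0 \<le> t \<Longrightarrow> 0 \<le> mass_kernel \<theta> t v"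
  by (simp add: mass_kernel_def)

lemma measurable_mass_kernel [measurable]:
  "(\<lambda>(t, v). mass_kernel \<theta> t v) \<in> borel_measurable (borel \<Otimes>\<^sub>M borel)"
  unfolding mass_kernel_def split_beta by measurable

text \<open>
  The substitution \<open>v = x / (t + x)\<close> turns the kernel into \<open>t powr (1 - \<theta>)\<close> times the integrand of
  \<open>\<Gamma>(\<theta>)\<close>. At \<open>t = 0\<close> both sides are 0, by the convention \<open>0 powr (1 - \<theta>) = 0\<close>, so the
  identity can be inserted at every sample point.
\<close>

lemma mass_kernel_integral:
  assumes \<theta>: "0 < \<theta>" and t: "0 \<le> t"
  shows "integrable lborel (mass_kernel \<theta> t)"
    and "(\<integral>v. mass_kernel \<theta> t v \<partial>lborel) = Gamma \<theta> * t powr (1 - \<theta>)"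
proof -
  have "integrable lborel (mass_kernel \<theta> t) \<and> (\<integral>v. mass_kernel \<theta> t v \<partial>lborel) = Gamma \<theta> * t powr (1 - \<theta>)"
  proof (cases "t = 0")
    case True
    then have "mass_kernel \<theta> t = (\<lambda>_. 0)" by (auto simp: mass_kernel_def)
    with True show ?thesis by simp
  next
    case False
    with t have t0: "0 < t" by simp
    let ?f = "\<lambda>v. v powr (\<theta> - 1) * (1 - v) powr (- \<theta> - 1) * (t * exp (- (t * (v / (1 - v)))))"
    let ?h = "\<lambda>x. x / (t + x)"
    let ?h' = "\<lambda>x. t / (t + x)\<^sup>2"
    have fh: "?f (?h x) * ?h' x = t powr (1 - \<theta>) * (x powr (\<theta> - 1) * exp (- x))" if x: "0 < x" for x
    proof -
      have 1: "1 - ?h x = t / (t + x)" using x t0 by (simp add: field_simps)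
      have 2: "t * (?h x / (1 - ?h x)) = x" unfolding 1 using x t0 by (simp add: add_pos_pos[THEN less_imp_neq, symmetric])
      have 3: "(t + x)\<^sup>2 = (t + x) powr 2" using x t0 by (simp add: powr_numeral)
      have 4: "t * t = t powr 2" using t0 by (simp add: powr_numeral power2_eq_square)
      have "?f (?h x) * ?h' x = (x powr (\<theta> - 1) / (t + x) powr (\<theta> - 1)) * (t powr (- \<theta> - 1) / (t + x) powr (- \<theta> - 1)) * (t * exp (- x)) * (t / (t + x)\<^sup>2)"
        unfolding 2 unfolding 1 using x t0 by (simp add: powr_divide)
      also have "\<dots> = x powr (\<theta> - 1) * exp (- x) * (t powr (- \<theta> - 1) * (t * t)) / ((t + x) powr (\<theta> - 1) * (t + x) powr (- \<theta> - 1) * (t + x)\<^sup>2)"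
        by simp
      also have "t powr (- \<theta> - 1) * (t * t) = t powr (1 - \<theta>)" unfolding 4 by (simp add: powr_add[symmetric])
      also have "(t + x) powr (\<theta> - 1) * (t + x) powr (- \<theta> - 1) * (t + x)\<^sup>2 = 1"
        unfolding 3 powr_add[symmetric] using x t0 by simp
      finally show ?thesis by simp
    qed
    have gd: "indicator {0<..} x *\<^sub>R (t powr (1 - \<theta>) * (x powr (\<theta> - 1) * exp (- x))) = (t powr (1 - \<theta>) * Gamma \<theta>) * gamma_density \<theta> x" for x
      using Gamma_real_pos[OF \<theta>] by (auto simp: gamma_density_def indicator_def)
    have e: "einterval (ereal 0) \<infinity> = {0<..}" "einterval (ereal 0) (ereal 1) = {0<..<1}" by (auto simp: einterval_def)
    have int: "set_integrable lborel (einterval (ereal 0) \<infinity>) (\<lambda>x. t powr (1 - \<theta>) * (x powr (\<theta> - 1) * exp (- x)))"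
      unfolding set_integrable_def e gd by (intro integrable_mult_right integrable_gamma_density \<theta>)
    have eq: "indicator {0<..} x *\<^sub>R (?f (?h x) * ?h' x) = indicator {0<..} x *\<^sub>R (t powr (1 - \<theta>) * (x powr (\<theta> - 1) * exp (- x)))" for x
    proof (cases "0 < x")
      case True
      then show ?thesis by (simp only: fh)
    qed simp
    have int': "set_integrable lborel (einterval (ereal 0) \<infinity>) (\<lambda>x. ?f (?h x) * ?h' x)"
      using int unfolding set_integrable_def e eq .
    have lim0: "((ereal \<circ> ?h \<circ> real_of_ereal) \<longlongrightarrow> ereal 0) (at_right (ereal 0))"
    proof -
      have "(?h \<longlongrightarrow> 0 / (t + 0)) (at_right 0)" using t0 by (intro tendsto_intros) auto
      then have "(?h \<longlongrightarrow> 0) (at_right 0)" by simp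
      then show ?thesis by (simp only: ereal_tendsto_simps comp_assoc; simp only: comp_def)
    qed
    have lim1: "((ereal \<circ> ?h \<circ> real_of_ereal) \<longlongrightarrow> ereal 1) (at_left \<infinity>)"
    proof -
      have "(?h \<longlongrightarrow> 1) at_top" using t0 by real_asymp
      then show ?thesis by (simp only: ereal_tendsto_simps comp_assoc; simp only: comp_def)
    qed
    have D: "DERIV ?h x :> ?h' x" if "0 < x" for x
      using that t0 by (auto intro!: derivative_eq_intros simp: power2_eq_square field_simps)
    have C: "isCont ?f (?h x)" if x: "0 < x" for x
    proof -
      have "0 < ?h x" "?h x < 1" using x t0 by auto
      then show ?thesis by (intro continuous_intros) auto
    qed
    have C': "isCont ?h' x" if "0 < x" for x using that t0 by (intro continuous_intros) auto
    have pos: "0 \<le> ?f v" for v using t0 by simp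
    have pos': "0 \<le> ?h' x" for x using t0 by simp
    define f h h' where "f = ?f" and "h = ?h" and "h' = ?h'"
    note facts = D C C' pos pos' lim0 lim1 int'
    have facts': "0 < x \<Longrightarrow> DERIV h x :> h' x" "0 < x \<Longrightarrow> isCont f (h x)" "0 < x \<Longrightarrow> isCont h' x"
      "0 \<le> f v" "0 \<le> h' x" "((ereal \<circ> h \<circ> real_of_ereal) \<longlongrightarrow> ereal 0) (at_right (ereal 0))"
      "((ereal \<circ> h \<circ> real_of_ereal) \<longlongrightarrow> ereal 1) (at_left \<infinity>)"
      "set_integrable lborel (einterval (ereal 0) \<infinity>) (\<lambda>x. f (h x) * h' x)" for x v
      unfolding f_def h_def h'_def by (rule facts, assumption?)+
    have "set_integrable lborel (einterval (ereal 0) (ereal 1)) f"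
      "(LBINT v=ereal 0..ereal 1. f v) = (LBINT x=ereal 0..\<infinity>. f (h x) * h' x)"
      by (rule interval_integral_substitution_nonneg[of "ereal 0" \<infinity> h h' f "ereal 0" "ereal 1"], use facts' in auto)+
    then have "set_integrable lborel (einterval (ereal 0) (ereal 1)) ?f"
      "(LBINT v=ereal 0..ereal 1. ?f v) = (LBINT x=ereal 0..\<infinity>. ?f (?h x) * ?h' x)"
      unfolding f_def h_def h'_def .
    moreover have "(LBINT x=ereal 0..\<infinity>. ?f (?h x) * ?h' x) = (LBINT x=ereal 0..\<infinity>. t powr (1 - \<theta>) * (x powr (\<theta> - 1) * exp (- x)))"
      by (simp only: interval_lebesgue_integral_def e set_lebesgue_integral_def eq ereal_less_eq if_True)
    moreover have "\<dots> = t powr (1 - \<theta>) * Gamma \<theta>"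
      unfolding interval_lebesgue_integral_def e set_lebesgue_integral_def gd
      using integral_gamma_density[OF \<theta>] by simp
    ultimately show ?thesis
      unfolding mass_kernel_def[abs_def] interval_lebesgue_integral_def e set_lebesgue_integral_def set_integrable_def
      by (simp add: mult.commute)
  qed
  then show "integrable lborel (mass_kernel \<theta> t)"
    and "(\<integral>v. mass_kernel \<theta> t v \<partial>lborel) = Gamma \<theta> * t powr (1 - \<theta>)" by auto
qed

context gamma_process_integrand
begin

text \<open>
  The scaling \<open>1 / u - i s g = (1 / u) (1 - i s u g)\<close> turns the joint transform with \<open>1 + c = 1 / u\<close>
  into that of \<open>X\<close> alone, and the total mass \<open>\<theta>\<close> of \<open>\<alpha>\<close> produces the power of \<open>u\<close>.
\<close>

lemma tilted_transform:
  assumes u: "0 < u" "u < 1"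
  shows "(\<integral>w. exp (- of_real ((1 - u) / u * mass w) + \<i> * of_real (s * X w)) \<partial>P) = of_real (u powr \<theta>) * \<Lambda> s u"
proof -
  have "Ln (1 + (of_real ((1 - u) / u) - \<i> * of_real (s * g x))) = of_real (- ln u) + Ln (1 - \<i> * of_real (s * u * g x))" for x
  proof -
    have nz: "1 - \<i> * complex_of_real (s * u * g x) \<noteq> 0"
      using one_plus_not_nonpos_Reals[of "- (\<i> * of_real (s * u * g x))"] by auto
    have "1 + (of_real ((1 - u) / u) - \<i> * of_real (s * g x)) = of_real (1 / u) * (1 - \<i> * of_real (s * u * g x))"
      using u by (simp add: field_simps)
    moreover have "Ln (1 / complex_of_real u) = - complex_of_real (ln u)"
      using Ln_of_real[of "1 / u"] u by (simp add: ln_div)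
    ultimately show ?thesis using Ln_times_of_real[OF _ nz, of "1 / u"] u by simp
  qed
  then have "(\<integral>w. exp (- of_real ((1 - u) / u * mass w) + \<i> * of_real (s * X w)) \<partial>P)
      = exp (- (\<integral>x. of_real (- ln u) + Ln (1 - \<i> * of_real (s * u * g x)) \<partial>\<alpha>))"
    using joint_transform[of "(1 - u) / u" s] u by simp
  also have "(\<integral>x. of_real (- ln u) + Ln (1 - \<i> * of_real (s * u * g x)) \<partial>\<alpha>) = of_real (- \<theta> * ln u) + log_integral s u"
    using integrable_Ln[of "s * u"] total
    by (subst Bochner_Integration.integral_add) (auto simp: log_integral_def space_shape scaleR_conv_of_real)
  also have "exp (- (of_real (- \<theta> * ln u) + log_integral s u)) = of_real (u powr \<theta>) * \<Lambda> s u"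
  proof -
    have "exp (- (of_real (- \<theta> * ln u) + log_integral s u)) = exp (complex_of_real (\<theta> * ln u)) * exp (- log_integral s u)"
      by (simp add: exp_add[symmetric])
    then show ?thesis using u by (simp only: exp_of_real \<Lambda>_eq powr_def) simp
  qed
  finally show ?thesis .
qed

lemma mass_nonneg: "0 \<le> mass w" by (simp add: mass_def)

text \<open>
  Both sides are the derivative of the tilted transform: the left one by differentiation under
  the expectation, the right one by the differential equation.
\<close>

lemma tilted_mass_transform:
  assumes u: "0 < u" "u < 1"
  shows "(\<integral>w. of_real (mass w / u\<^sup>2) * exp (- of_real ((1 - u) / u * mass w) + \<i> * of_real (s * X w)) \<partial>P)
    = of_real (\<theta> * u powr (\<theta> - 1)) * (\<Lambda> s u * \<Psi> s u)"
proof (rule vector_derivative_unique_at)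
  show "((\<lambda>u. \<integral>w. exp (- of_real ((1 - u) / u * mass w) + \<i> * of_real (s * X w)) \<partial>P) has_vector_derivative
    of_real (\<theta> * u powr (\<theta> - 1)) * (\<Lambda> s u * \<Psi> s u)) (at u)"
    by (rule has_vector_derivative_transform_within_open[OF ode.powr_solution_derivative[OF u(1)], of "{0<..<1}"])
       (use u tilted_transform in auto)
  define a b where "a = u / 2" and "b = (1 + u) / 2"
  have ab: "0 < a" "a < u" "u < b" "b < 1" using u by (auto simp: a_def b_def)
  define C where "C = 1 / (a\<^sup>2 * ((1 - b) / b))"
  show "((\<lambda>u. \<integral>w. exp (- of_real ((1 - u) / u * mass w) + \<i> * of_real (s * X w)) \<partial>P) has_vector_derivative
    (\<integral>w. of_real (mass w / u\<^sup>2) * exp (- of_real ((1 - u) / u * mass w) + \<i> * of_real (s * X w)) \<partial>P)) (at u)"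
  proof (rule has_vector_derivative_integral_dominated[where a=a and b=b and B="\<lambda>_. C"])
    fix t assume t: "a < t" "t < b"
    then have t0: "0 < t" "t < 1" using ab by auto
    show "complex_integrable P (\<lambda>w. exp (- of_real ((1 - t) / t * mass w) + \<i> * of_real (s * X w)))"
      using t0 mass_nonneg by (intro P.integrable_const_bound[of _ 1]) (auto simp: zero_le_mult_iff zero_le_divide_iff)
    fix w
    have "((\<lambda>t. (1 - t) / t * mass w) has_real_derivative - (mass w / t\<^sup>2)) (at t)"
      using t0 by (auto intro!: derivative_eq_intros simp: field_simps power2_eq_square)
    then have "((\<lambda>t. complex_of_real ((1 - t) / t * mass w)) has_vector_derivative of_real (- (mass w / t\<^sup>2))) (at t)"
      by (intro has_vector_derivative_of_real) (simp add: has_real_derivative_iff_has_vector_derivative)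
    moreover have "((\<lambda>z. exp (- z + \<i> * of_real (s * X w))) has_field_derivative
        - exp (- of_real ((1 - t) / t * mass w) + \<i> * of_real (s * X w))) (at (complex_of_real ((1 - t) / t * mass w)))"
      by (auto intro!: derivative_eq_intros)
    ultimately have "(((\<lambda>z. exp (- z + \<i> * of_real (s * X w))) \<circ> (\<lambda>t. complex_of_real ((1 - t) / t * mass w))) has_vector_derivative
       of_real (- (mass w / t\<^sup>2)) * - exp (- of_real ((1 - t) / t * mass w) + \<i> * of_real (s * X w))) (at t)"
      by (rule field_vector_diff_chain_at)
    then show "((\<lambda>t. exp (- of_real ((1 - t) / t * mass w) + \<i> * of_real (s * X w))) has_vector_derivative
      of_real (mass w / t\<^sup>2) * exp (- of_real ((1 - t) / t * mass w) + \<i> * of_real (s * X w))) (at t)"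
      by (simp only: comp_def of_real_minus minus_mult_minus)
    define c where "c = (1 - t) / t * mass w"
    define c0 where "c0 = (1 - b) / b"
    have c0: "0 < c0" using ab by (simp add: c0_def)
    \<comment> \<open>the rate \<open>(1 - t) / t\<close> is at least \<open>c0\<close> on the interval, and \<open>y exp (- c0 y) \<le> 1 / c0\<close>\<close>
    have "c0 \<le> (1 - t) / t" unfolding c0_def using t t0 ab by (simp add: field_simps)
    then have "c0 * mass w \<le> c" unfolding c_def using mass_nonneg by (intro mult_right_mono) auto
    then have "mass w \<le> c / c0" using c0 by (simp add: field_simps)
    also have "c \<le> exp c" using exp_ge_add_one_self[of c] by linarith
    finally have m: "mass w * exp (- c) \<le> 1 / c0"
      using c0 by (simp add: exp_minus field_simps)
    have "norm (of_real (mass w / t\<^sup>2) * exp (- of_real c + \<i> * of_real (s * X w))) = mass w * exp (- c) / t\<^sup>2"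
      using mass_nonneg[of w] by (simp add: norm_mult norm_divide norm_power)
    also have "\<dots> \<le> (1 / c0) / t\<^sup>2" using m by (intro divide_right_mono) auto
    also have "\<dots> \<le> (1 / c0) / a\<^sup>2" using t ab c0 by (intro divide_left_mono power_mono) auto
    also have "\<dots> = C" by (simp add: C_def c0_def)
    finally show "norm (of_real (mass w / t\<^sup>2) * exp (- of_real ((1 - t) / t * mass w) + \<i> * of_real (s * X w))) \<le> C"
      unfolding c_def .
  qed (use ab in auto)
qed

text \<open>
  Insert the mixture for the power of the mass, exchange the integrals, and evaluate each member by
  \<open>tilted_mass_transform\<close>. The powers of \<open>u\<close> cancel, and what remains is the beta density.
\<close>

lemma mass_power_transform:
  assumes int: "integrable P (\<lambda>w. Gamma \<theta> * mass w powr (1 - \<theta>))"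
  shows "(\<integral>w. (Gamma \<theta> * mass w powr (1 - \<theta>)) *\<^sub>R iexp (s * X w) \<partial>P) =
    (\<integral>u. beta_density 1 \<theta> u *\<^sub>R (\<Lambda> s u * \<Psi> s u) \<partial>lborel)"
proof -
  interpret PL: pair_sigma_finite P lborel ..
  let ?h = "\<lambda>w v. mass_kernel \<theta> (mass w) v *\<^sub>R iexp (s * X w)"
  have [measurable]: "(\<lambda>p. mass_kernel \<theta> (mass (fst p)) (snd p)) \<in> borel_measurable (P \<Otimes>\<^sub>M lborel)"
    using measurable_compose[OF _ measurable_mass_kernel[of \<theta>], of "\<lambda>p. (mass (fst p), snd p)" "P \<Otimes>\<^sub>M lborel"] by simp
  note k = mass_kernel_integral[OF \<theta> mass_nonneg]
  have hint: "integrable (P \<Otimes>\<^sub>M lborel) (case_prod ?h)"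
  proof (rule PL.Fubini_integrable)
    show "case_prod ?h \<in> borel_measurable (P \<Otimes>\<^sub>M lborel)" unfolding split_beta by measurable
    show "integrable P (\<lambda>w. \<integral>v. norm (case (w, v) of (w, v) \<Rightarrow> ?h w v) \<partial>lborel)"
      using int k mass_kernel_nonneg[OF mass_nonneg, of \<theta>] by simp
    show "AE w in P. integrable lborel (\<lambda>v. case (w, v) of (w, v) \<Rightarrow> ?h w v)"
      using k by (intro AE_I2) simp
  qed
  have "(\<integral>w. (Gamma \<theta> * mass w powr (1 - \<theta>)) *\<^sub>R iexp (s * X w) \<partial>P) = (\<integral>w. \<integral>v. ?h w v \<partial>lborel \<partial>P)"
    using k by simp
  also have "\<dots> = (\<integral>v. \<integral>w. ?h w v \<partial>P \<partial>lborel)"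
    by (rule PL.Fubini_integral[OF hint, symmetric])
  also have "\<dots> = (\<integral>v. beta_density 1 \<theta> (1 - v) *\<^sub>R (\<Lambda> s (1 - v) * \<Psi> s (1 - v)) \<partial>lborel)"
  proof (rule Bochner_Integration.integral_cong[OF refl])
    fix v :: real
    show "(\<integral>w. ?h w v \<partial>P) = beta_density 1 \<theta> (1 - v) *\<^sub>R (\<Lambda> s (1 - v) * \<Psi> s (1 - v))"
    proof (cases "0 < v \<and> v < 1")
      case False
      then show ?thesis by (auto simp: mass_kernel_def beta_density_def)
    next
      case True
      define u where "u = 1 - v"
      have u: "0 < u" "u < 1" "v = 1 - u" using True by (auto simp: u_def)
      define r where "r = v powr (\<theta> - 1) * u powr (1 - \<theta>)"
      have u2: "u powr (- \<theta> - 1) = u powr (1 - \<theta>) / u\<^sup>2"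
      proof -
        have "- \<theta> - 1 = (1 - \<theta>) - 2" by simp
        then show ?thesis using u by (simp only: powr_diff) (simp add: powr_numeral)
      qed
      have h: "?h w v = of_real r * (of_real (mass w / u\<^sup>2) * exp (- of_real ((1 - u) / u * mass w) + \<i> * of_real (s * X w)))" for w
      proof -
        have "mass_kernel \<theta> (mass w) v = r * (mass w / u\<^sup>2) * exp (- ((1 - u) / u * mass w))"
          using u by (simp add: mass_kernel_def r_def u2 mult_ac)
        then show ?thesis
          by (simp only: scaleR_conv_of_real of_real_mult exp_of_real[symmetric] exp_add of_real_minus mult.assoc)
      qed
      have "(\<integral>w. ?h w v \<partial>P) = of_real r * (of_real (\<theta> * u powr (\<theta> - 1)) * (\<Lambda> s u * \<Psi> s u))"
        by (simp only: h integral_mult_right_zero tilted_mass_transform[OF u(1,2)])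
      also have "\<dots> = of_real (r * (\<theta> * u powr (\<theta> - 1))) * (\<Lambda> s u * \<Psi> s u)" by simp
      also have "r * (\<theta> * u powr (\<theta> - 1)) = \<theta> * v powr (\<theta> - 1) * (u powr (1 - \<theta>) * u powr (\<theta> - 1))"
        by (simp add: r_def)
      also have "u powr (1 - \<theta>) * u powr (\<theta> - 1) = 1" using u by (simp add: powr_add[symmetric])
      also have "\<theta> * v powr (\<theta> - 1) * 1 = beta_density 1 \<theta> u"
        using u \<theta> by (simp add: beta_density_1_left)
      finally show ?thesis by (simp add: u_def scaleR_conv_of_real)
    qed
  qed
  also have "\<dots> = (\<integral>u. beta_density 1 \<theta> u *\<^sub>R (\<Lambda> s u * \<Psi> s u) \<partial>lborel)"
    by (subst (2) lborel_integral_real_affine[where c="-1" and t=1]) simp_all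
  finally show ?thesis .
qed

end

section \<open>The distributional equalities\<close>

lemma integral_scale_measure:
  fixes f :: "'a \<Rightarrow> 'b::{banach, second_countable_topology}"
  assumes r: "0 \<le> r" and f: "f \<in> borel_measurable M"
  shows "(\<integral>x. f x \<partial>scale_measure (ennreal r) M) = r *\<^sub>R (\<integral>x. f x \<partial>M)"
proof -
  have "scale_measure (ennreal r) M = density M (\<lambda>_. ennreal r)"
    by (rule measure_eqI) (auto simp: emeasure_density nn_integral_cmult_indicator)
  then show ?thesis using r f by (simp add: integral_density)
qed

lemma (in prob_space) integral_distr_density:
  fixes h :: "real \<Rightarrow> complex"
  assumes U: "distributed M lborel U (\<lambda>x. ennreal (d x))" and d: "\<And>x. 0 \<le> d x"
    and [measurable]: "d \<in> borel_measurable borel" "h \<in> borel_measurable borel"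
  shows "(\<integral>u. h u \<partial>distr M borel U) = (\<integral>u. d u *\<^sub>R h u \<partial>lborel)"
  unfolding distr_borel_density[OF U] by (rule integral_density) (auto simp: d)

lemma beta_density_nonneg: "0 < a \<Longrightarrow> 0 < b \<Longrightarrow> 0 \<le> beta_density a b x"
  by (simp add: beta_density_def Beta_def Gamma_real_pos less_imp_le)

lemma distr_eqI_char:
  assumes "prob_space M" "prob_space N" "X \<in> borel_measurable M" "Y \<in> borel_measurable N"
    and "\<And>s. char (distr M borel X) s = char (distr N borel Y) s"
  shows "distr M borel X = distr N borel Y"
  using assms by (intro Levy_uniqueness prob_space.real_distribution_distr) auto

lemma gamma_process_integrand_scale:
  fixes H :: "'a::polish_space measure"
  assumes H: "prob_space H" "sets H = sets borel" and \<theta>: "0 < \<theta>" and g: "g \<in> borel_measurable borel"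
    and log: "(\<integral>\<^sup>+ y. ennreal (ln (1 + \<bar>g y\<bar>)) \<partial>(scale_measure (ennreal \<theta>) H)) < \<infinity>"
    and gp: "gamma_process P (scale_measure (ennreal \<theta>) H) \<mu>"
  shows "gamma_process_integrand P (scale_measure (ennreal \<theta>) H) \<mu> g \<theta>"
proof (rule gamma_process_integrand.intro)
  interpret H: prob_space H by fact
  have sp: "space H = UNIV" using sets_eq_imp_space_eq[OF H(2)] by simp
  have one: "emeasure H UNIV = 1" using H.emeasure_space_1 sp by simp
  show "finite_measure (scale_measure (ennreal \<theta>) H)"
    by (rule finite_measureI) (simp add: space_scale_measure sp one)
  show "measure (scale_measure (ennreal \<theta>) H) UNIV = \<theta>"
    using \<theta> by (simp add: measure_def one)
qed (use H \<theta> g log gp in auto)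

lemma char_perturbed_beta:
  fixes H :: "'a::polish_space measure" and \<mu> :: "'w \<Rightarrow> 'a measure"
  assumes gi: "gamma_process_integrand P (scale_measure (ennreal \<theta>) H) \<mu> g \<theta>"
    and H: "sets H = sets borel"
    and T: "distributed P lborel T (\<lambda>x. ennreal (gamma_density 1 x))"
    and Y: "Y \<in> measurable P borel" "distr P borel Y = H"
    and ab: "0 < a" "0 < b"
    and U: "distributed P lborel U (\<lambda>x. ennreal (beta_density a b x))"
    and ind: "indep_events_of P [events_of P bf_measures \<mu>, events_of P borel U, events_of P borel T, events_of P borel Y]"
  shows "char (distr P borel (\<lambda>w. U w * (\<integral>y. g y \<partial>\<mu> w) + U w * T w * g (Y w))) s =
    (\<integral>u. beta_density a b u *\<^sub>R (gamma_process_integrand.\<Lambda> P \<mu> g s u *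
       gamma_process_integrand.\<Psi> (scale_measure (ennreal \<theta>) H) g \<theta> s u) \<partial>lborel)"
proof -
  interpret gamma_process_integrand P "scale_measure (ennreal \<theta>) H" \<mu> g \<theta> by (rule gi)
  have Um: "U \<in> borel_measurable P" using distributed_measurable[OF U] by simp
  have \<Psi>: "(\<integral>y. 1 / (1 - \<i> * of_real (s * u * g y)) \<partial>H) = \<Psi> s u" for u
    unfolding \<Psi>_def using \<theta> H g
    by (subst integral_scale_measure) (auto simp: scaleR_conv_of_real cong: measurable_cong_sets)
  have "char (distr P borel (\<lambda>w. U w * (\<integral>y. g y \<partial>\<mu> w) + U w * T w * g (Y w))) s =
    (\<integral>u. \<Lambda> s u * \<Psi> s u \<partial>distr P borel U)"
    unfolding P.char_perturbed[OF mu Um T Y(1) g ind] Y(2) \<Psi> by (simp add: \<Lambda>_def X_def[abs_def])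
  also have "\<dots> = (\<integral>u. beta_density a b u *\<^sub>R (\<Lambda> s u * \<Psi> s u) \<partial>lborel)"
    using ab by (intro P.integral_distr_density[OF U]) (auto simp: beta_density_nonneg)
  finally show ?thesis .
qed

lemma char_scaled_beta:
  fixes \<mu> :: "'w \<Rightarrow> 'a::polish_space measure"
  assumes gi: "gamma_process_integrand P \<alpha> \<mu> g \<theta>"
    and ab: "0 < a" "0 < b"
    and V: "distributed P lborel V (\<lambda>x. ennreal (beta_density a b x))"
    and ind: "indep_events_of P [events_of P bf_measures \<mu>, events_of P borel V]"
  shows "char (distr P borel (\<lambda>w. V w * (\<integral>y. g y \<partial>\<mu> w))) s =
    (\<integral>u. beta_density a b u *\<^sub>R gamma_process_integrand.\<Lambda> P \<mu> g s u \<partial>lborel)"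
proof -
  interpret gamma_process_integrand P \<alpha> \<mu> g \<theta> by (rule gi)
  have Vm [measurable]: "V \<in> borel_measurable P" using distributed_measurable[OF V] by simp
  define Z where "Z i = [X, V] ! i" for i
  have Z [simp]: "Z 0 = X" "Z (Suc 0) = V" by (simp_all add: Z_def)
  let ?Es = "[events_of P bf_measures \<mu>, events_of P borel V]"
  have lt2: "i < length ?Es \<Longrightarrow> i = 0 \<or> i = Suc 0" for i by auto
  have "P.indep_vars (\<lambda>_. borel) Z {..<length ?Es}"
  proof (rule P.indep_vars_of_indep_events_of[OF ind])
    show "Z i \<in> borel_measurable P" if "i < length ?Es" for i
      using lt2[OF that] by auto
    show "events_of P borel (Z i) \<subseteq> ?Es ! i" if "i < length ?Es" for i
      using lt2[OF that] events_of_comp_subset[OF mu integral_measurable_bf_measures[OF g]] by (auto simp: X_def[abs_def])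
  qed
  then have iv: "P.indep_vars (\<lambda>_. borel) Z {0, 1}"
    by (rule P.indep_vars_subset) auto
  have i: "P.indep_var borel V borel X"
    using P.indep_var_functions[OF iv, of "{1}" "{0}" "\<lambda>f. f 1" "\<lambda>f. f 0"] by simp
  have "char (distr P borel (\<lambda>w. V w * (\<integral>y. g y \<partial>\<mu> w))) s = (\<integral>u. \<Lambda> s u \<partial>distr P borel V)"
    using P.char_distr_mult[OF i, of s] by (simp add: \<Lambda>_def X_def)
  also have "\<dots> = (\<integral>u. beta_density a b u *\<^sub>R \<Lambda> s u \<partial>lborel)"
    using ab by (intro P.integral_distr_density[OF V]) (auto simp: beta_density_nonneg)
  finally show ?thesis .
qed

text \<open>
  The law of the integral depends on the shape only. This identifies the process on the
  sample space with the canonical process behind the beta-gamma law.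
\<close>

lemma characteristic_shape_only:
  assumes "gamma_process_integrand P \<alpha> \<mu> g \<theta>" "gamma_process_integrand P' \<alpha> \<mu>' g \<theta>"
  shows "gamma_process_integrand.\<Lambda> P \<mu> g s u = gamma_process_integrand.\<Lambda> P' \<mu>' g s u"
  by (simp only: gamma_process_integrand.\<Lambda>_eq[OF assms(1)] gamma_process_integrand.\<Lambda>_eq[OF assms(2)])

lemma char_beta_gamma:
  fixes H :: "'a::polish_space measure" and \<mu> :: "'w \<Rightarrow> 'a measure" and \<mu>BG :: "'v \<Rightarrow> 'a measure"
  assumes gi: "gamma_process_integrand P (scale_measure (ennreal \<theta>) H) \<mu> g \<theta>"
    and Q: "prob_space Q" and bg [measurable]: "\<mu>BG \<in> measurable Q bf_measures"
    and law: "beta_gamma_law \<theta> H (distr Q bf_measures \<mu>BG)"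
  shows "char (distr Q borel (\<lambda>w. \<integral>y. g y \<partial>\<mu>BG w)) s =
    (\<integral>u. beta_density 1 \<theta> u *\<^sub>R (gamma_process_integrand.\<Lambda> P \<mu> g s u *
       gamma_process_integrand.\<Psi> (scale_measure (ennreal \<theta>) H) g \<theta> s u) \<partial>lborel)"
proof -
  interpret P: gamma_process_integrand P "scale_measure (ennreal \<theta>) H" \<mu> g \<theta> by (rule gi)
  obtain G where G: "gamma_process_law (scale_measure (ennreal \<theta>) H) G"
    and L: "distr Q bf_measures \<mu>BG = density G (\<lambda>m. ennreal (Gamma \<theta> * measure m (space m) powr (- (\<theta> - 1))))"
    using law by (auto simp: beta_gamma_law_def)
  interpret G: gamma_process_integrand G "scale_measure (ennreal \<theta>) H" "\<lambda>m. m" g \<theta>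
    using G P.fin P.sets P.total P.\<theta> P.g P.log by unfold_locales (auto simp: gamma_process_law_def)
  interpret Q: prob_space Q by (rule Q)
  have sG [measurable_cong]: "sets G = sets bf_measures" using G by (simp add: gamma_process_law_def)
  have D: "measure m (space m) = G.mass m" if "m \<in> space G" for m
  proof -
    have "sets m = sets borel"
      using that sets_eq_imp_space_eq[OF sG] by (simp add: space_bf_measures boundedly_finite_def)
    then have "space m = UNIV" using sets_eq_imp_space_eq by fastforce
    then show ?thesis by (simp add: G.mass_def)
  qed
  have L': "distr Q bf_measures \<mu>BG = density G (\<lambda>m. ennreal (Gamma \<theta> * G.mass m powr (1 - \<theta>)))"
  proof -
    have [measurable]: "(\<lambda>m. ennreal (Gamma \<theta> * G.mass m powr (1 - \<theta>))) \<in> borel_measurable G" by measurable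
    then have "(\<lambda>m. ennreal (Gamma \<theta> * measure m (space m) powr (- (\<theta> - 1)))) \<in> borel_measurable G"
      by (rule measurable_cong[THEN iffD2, rotated]) (simp add: D)
    then show ?thesis unfolding L by (intro density_cong) (auto simp: D)
  qed
  have nonneg: "0 \<le> Gamma \<theta> * G.mass m powr (1 - \<theta>)" for m using P.\<theta> by (simp add: Gamma_real_pos less_imp_le)
  interpret L: prob_space "density G (\<lambda>m. ennreal (Gamma \<theta> * G.mass m powr (1 - \<theta>)))"
    unfolding L'[symmetric] by (rule Q.prob_space_distr) (rule bg)
  have int: "integrable G (\<lambda>m. Gamma \<theta> * G.mass m powr (1 - \<theta>))"
  proof (rule integrableI_nonneg)
    have "(\<integral>\<^sup>+m. ennreal (Gamma \<theta> * G.mass m powr (1 - \<theta>)) \<partial>G) = 1"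
      using L.emeasure_space_1 by (subst (asm) emeasure_density) (auto cong: nn_integral_cong_simp)
    then show "(\<integral>\<^sup>+m. ennreal (Gamma \<theta> * G.mass m powr (1 - \<theta>)) \<partial>G) < \<infinity>" by simp
  qed (use nonneg in auto)
  have Xm [measurable]: "G.X \<in> borel_measurable bf_measures"
    unfolding G.X_def[abs_def] by (rule integral_measurable_bf_measures[OF P.g])
  have [measurable]: "(\<lambda>w. \<integral>y. g y \<partial>\<mu>BG w) \<in> borel_measurable Q"
    using measurable_compose[OF bg Xm] by (simp add: G.X_def)
  have "char (distr Q borel (\<lambda>w. \<integral>y. g y \<partial>\<mu>BG w)) s = (\<integral>w. iexp (s * G.X (\<mu>BG w)) \<partial>Q)"
    by (simp add: char_def integral_distr G.X_def)
  also have "\<dots> = (\<integral>m. iexp (s * G.X m) \<partial>distr Q bf_measures \<mu>BG)"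
    by (subst integral_distr[OF bg]) auto
  also have "\<dots> = (\<integral>m. (Gamma \<theta> * G.mass m powr (1 - \<theta>)) *\<^sub>R iexp (s * G.X m) \<partial>G)"
    unfolding L' by (rule integral_density) (use nonneg in auto)
  also have "\<dots> = (\<integral>u. beta_density 1 \<theta> u *\<^sub>R (G.\<Lambda> s u * G.\<Psi> s u) \<partial>lborel)"
    by (rule G.mass_power_transform[OF int])
  finally show ?thesis
    by (simp only: characteristic_shape_only[OF G.gamma_process_integrand_axioms gi])
qed

text \<open>
  The density is the total mass to the power 0, which is 1 unless the mass is 0. This mass is gamma distributed with shape 1
  and so is almost surely positive and finite; the defining properties of a gamma process then pass from
  the canonical process to any variable with that law.
\<close>

lemma beta_gamma_law_1:
  fixes H :: "'a::polish_space measure" and \<mu>BG :: "'v \<Rightarrow> 'a measure"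
  assumes H: "prob_space H" "sets H = sets borel"
    and Q: "prob_space Q" and bg [measurable]: "\<mu>BG \<in> measurable Q bf_measures"
    and law: "beta_gamma_law 1 H (distr Q bf_measures \<mu>BG)"
  shows "gamma_process Q H \<mu>BG"
proof -
  interpret H: prob_space H by fact
  interpret Q: prob_space Q by fact
  have sp: "space H = UNIV" using sets_eq_imp_space_eq[OF H(2)] by simp
  have one: "measure H UNIV = 1" using H.prob_space sp by simp
  have "scale_measure 1 H = H" by simp
  with law obtain G where G: "gamma_process G H (\<lambda>m. m)" and sG [measurable_cong]: "sets G = sets bf_measures"
    and L: "distr Q bf_measures \<mu>BG = density G (\<lambda>m. ennreal (Gamma 1 * measure m (space m) powr (- (1 - 1))))"
    by (auto simp: beta_gamma_law_def gamma_process_law_def)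
  interpret G: prob_space G using G by (simp add: gamma_process_def)
  have spm: "space m = UNIV" if "m \<in> space G" for m
  proof -
    have "sets m = sets borel"
      using that sets_eq_imp_space_eq[OF sG] by (simp add: space_bf_measures boundedly_finite_def)
    then show ?thesis using sets_eq_imp_space_eq by fastforce
  qed
  have em [measurable]: "(\<lambda>m. emeasure m UNIV) \<in> borel_measurable G" using measurable_emeasure_bf_measures[of UNIV] by simp
  have mm [measurable]: "(\<lambda>m. measure m UNIV) \<in> borel_measurable G" using measure_measurable_bf_measures[of UNIV] by simp
  have d: "distr G borel (\<lambda>m. emeasure m UNIV) = distr (gamma_distribution 1) borel ennreal"
    using G one by (simp add: gamma_process_def)
  have "AE x in gamma_distribution 1. 0 < x"
    unfolding gamma_distribution_def by (subst if_not_P, simp, subst AE_density) (auto simp: gamma_density_def)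
  then have "AE x in distr (gamma_distribution 1) borel ennreal. x \<noteq> 0 \<and> x \<noteq> \<infinity>"
    by (subst AE_distr_iff) (auto simp: gamma_distribution_def)
  then have "AE m in G. emeasure m UNIV \<noteq> 0 \<and> emeasure m UNIV \<noteq> \<infinity>"
    unfolding d[symmetric] by (subst (asm) AE_distr_iff) auto
  then have "AE m in G. Gamma 1 * measure m (space m) powr (- (1 - 1)) = (1::real)"
    using AE_space by eventually_elim (auto simp: spm measure_def enn2real_eq_0_iff)
  then have "distr Q bf_measures \<mu>BG = density G (\<lambda>_. 1)"
  proof -
    assume AE: "AE m in G. Gamma 1 * measure m (space m) powr (- (1 - 1)) = (1::real)"
    have "(\<lambda>m. ennreal (Gamma 1 * measure m (space m) powr (- (1 - 1)))) \<in> borel_measurable G"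
      by (rule measurable_cong[THEN iffD2, of _ _ "\<lambda>m. ennreal (Gamma 1 * measure m UNIV powr (- (1 - 1)))"]) (simp_all add: spm)
    then show ?thesis unfolding L using AE by (intro density_cong) auto
  qed
  then have QG: "distr Q bf_measures \<mu>BG = G" by (simp add: density_1)
  have dist: "distr Q N (\<lambda>w. F (\<mu>BG w)) = distr G N F" if "F \<in> measurable bf_measures N" for N and F :: "'a measure \<Rightarrow> 'b"
    unfolding QG[symmetric] using that by (subst distr_distr) (auto simp: comp_def)
  show ?thesis
    unfolding gamma_process_def
  proof (intro conjI allI impI ballI)
    show "prob_space Q" "\<mu>BG \<in> measurable Q bf_measures" by fact+
    show "distr Q borel (\<lambda>w. emeasure (\<mu>BG w) A) = distr (gamma_distribution (measure H A)) borel ennreal" if "A \<in> sets borel" for A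
      using dist[OF measurable_emeasure_bf_measures[OF that]] G that by (simp add: gamma_process_def)
    fix n :: nat and A :: "nat \<Rightarrow> 'a set" assume A: "\<forall>i<n. A i \<in> sets borel" "disjoint_family_on A {..<n}"
    have Am: "(\<lambda>m. emeasure m (A i)) \<in> borel_measurable bf_measures" if "i < n" for i
      using A that by (intro measurable_emeasure_bf_measures) auto
    have iG: "G.indep_vars (\<lambda>_. borel) (\<lambda>i m. emeasure m (A i)) {..<n}"
      using G A by (simp add: gamma_process_def)
    show "Q.indep_vars (\<lambda>_. borel) (\<lambda>i w. emeasure (\<mu>BG w) (A i)) {..<n}"
      unfolding Q.indep_vars_def2
    proof (intro conjI ballI Q.indep_setsI)
      show rv: "(\<lambda>w. emeasure (\<mu>BG w) (A i)) \<in> borel_measurable Q" if "i \<in> {..<n}" for i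
        using measurable_compose[OF bg Am] that by simp
      then show "{(\<lambda>w. emeasure (\<mu>BG w) (A i)) -` B \<inter> space Q |B. B \<in> sets borel} \<subseteq> Q.events" if "i \<in> {..<n}" for i
        using that by (auto intro: measurable_sets)
      fix E J assume J: "J \<noteq> {}" "J \<subseteq> {..<n}" "finite J"
        and E: "\<forall>j\<in>J. E j \<in> {(\<lambda>w. emeasure (\<mu>BG w) (A j)) -` B \<inter> space Q |B. B \<in> sets borel}"
      then obtain B where B: "\<And>j. j \<in> J \<Longrightarrow> B j \<in> sets borel \<and> E j = (\<lambda>w. emeasure (\<mu>BG w) (A j)) -` B j \<inter> space Q"
        by simp metis
      define S where "S j = (\<lambda>m. emeasure m (A j)) -` B j \<inter> space G" for j
      have S: "S j \<in> sets bf_measures" if "j \<in> J" for j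
        unfolding S_def sets_eq_imp_space_eq[OF sG] using that J B Am by (intro measurable_sets) auto
      have ES: "E j = \<mu>BG -` S j \<inter> space Q" if "j \<in> J" for j
        using B[OF that] measurable_space[OF bg] sets_eq_imp_space_eq[OF sG] by (auto simp: S_def)
      have tr: "Q.prob (\<mu>BG -` C \<inter> space Q) = G.prob C" if "C \<in> sets bf_measures" for C
        using measure_distr[OF bg that] by (simp add: QG)
      have "(\<Inter>j\<in>J. E j) = \<mu>BG -` (\<Inter>j\<in>J. S j) \<inter> space Q"
        using J ES by auto
      then have "Q.prob (\<Inter>j\<in>J. E j) = G.prob (\<Inter>j\<in>J. S j)"
        using tr[of "\<Inter>j\<in>J. S j"] S J by (simp add: sets.finite_INT)
      also have "\<dots> = (\<Prod>j\<in>J. G.prob (S j))"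
        unfolding S_def using G.indep_varsD[OF iG J(1,3,2), of B] B by simp
      also have "\<dots> = (\<Prod>j\<in>J. Q.prob (E j))"
        using tr S ES by (intro prod.cong) auto
      finally show "Q.prob (\<Inter>j\<in>J. E j) = (\<Prod>j\<in>J. Q.prob (E j))" .
    qed
  qed
qed

theorem proposition4p1:
  fixes H :: "'a::polish_space measure"
    and g :: "'a \<Rightarrow> real"
    and \<theta> :: real
    and P :: "'w measure"
    and Q :: "'v measure"
    and \<mu> :: "'w \<Rightarrow> 'a measure"
    and \<mu>BG :: "'v \<Rightarrow> 'a measure"
    and T :: "'w \<Rightarrow> real"
    and Y :: "'w \<Rightarrow> 'a"
  assumes "prob_space H" and "sets H = sets borel" and "nonatomic H"
    and "0 < \<theta>"
    and "g \<in> borel_measurable borel"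
    and "(\<integral>\<^sup>+ y. ennreal (ln (1 + \<bar>g y\<bar>)) \<partial>(scale_measure (ennreal \<theta>) H)) < \<infinity>"
    and "prob_space Q" and "\<mu>BG \<in> measurable Q bf_measures"
    and "beta_gamma_law \<theta> H (distr Q bf_measures \<mu>BG)"
    and "prob_space P"
    and "gamma_process P (scale_measure (ennreal \<theta>) H) \<mu>"
    and "distributed P lborel T (\<lambda>x. ennreal (gamma_density 1 x))"
    and "Y \<in> measurable P borel" and "distr P borel Y = H"
  shows "(\<forall>U. distributed P lborel U (\<lambda>x. ennreal (beta_density 1 \<theta> x)) \<longrightarrow>
           indep_events_of P [events_of P bf_measures \<mu>, events_of P borel U,
                              events_of P borel T, events_of P borel Y] \<longrightarrow>
           distr Q borel (\<lambda>w. \<integral>y. g y \<partial>\<mu>BG w) =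
           distr P borel (\<lambda>w. U w * (\<integral>y. g y \<partial>\<mu> w) + U w * T w * g (Y w)))
       \<and> (1 < \<theta> \<longrightarrow>
         (\<forall>V U. distributed P lborel V (\<lambda>x. ennreal (beta_density 1 (\<theta> - 1) x)) \<longrightarrow>
           indep_events_of P [events_of P bf_measures \<mu>, events_of P borel V] \<longrightarrow>
           distributed P lborel U (\<lambda>x. ennreal (beta_density 1 \<theta> x)) \<longrightarrow>
           indep_events_of P [events_of P bf_measures \<mu>, events_of P borel U,
                              events_of P borel T, events_of P borel Y] \<longrightarrow>
           distr P borel (\<lambda>w. V w * (\<integral>y. g y \<partial>\<mu> w)) =
           distr P borel (\<lambda>w. U w * (\<integral>y. g y \<partial>\<mu> w) + U w * T w * g (Y w))))
       \<and> (\<theta> = 1 \<longrightarrow>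
         gamma_process Q H \<mu>BG \<and>
         (\<forall>U. distributed P lborel U (\<lambda>x. ennreal (beta_density 1 1 x)) \<longrightarrow>
           indep_events_of P [events_of P bf_measures \<mu>, events_of P borel U,
                              events_of P borel T, events_of P borel Y] \<longrightarrow>
           distr P borel (\<lambda>w. \<integral>y. g y \<partial>\<mu> w) =
           distr P borel (\<lambda>w. U w * (\<integral>y. g y \<partial>\<mu> w) + U w * T w * g (Y w))))
       \<and> (\<forall>U. distributed P lborel U (\<lambda>x. ennreal (beta_density \<theta> 1 x)) \<longrightarrow>
           indep_events_of P [events_of P bf_measures \<mu>, events_of P borel U,
                              events_of P borel T, events_of P borel Y] \<longrightarrow>
           distr P borel (\<lambda>w. \<integral>y. g y \<partial>\<mu> w) =
           distr P borel (\<lambda>w. U w * (\<integral>y. g y \<partial>\<mu> w) + U w * T w * g (Y w)))"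
proof -
  let ?\<alpha> = "scale_measure (ennreal \<theta>) H"
  let ?Z = "\<lambda>U w. U w * (\<integral>y. g y \<partial>\<mu> w) + U w * T w * g (Y w)"
  note H = \<open>prob_space H\<close> \<open>sets H = sets borel\<close>
  note \<theta> = \<open>0 < \<theta>\<close> and Q = \<open>prob_space Q\<close> and bg = \<open>\<mu>BG \<in> measurable Q bf_measures\<close>
  have gi: "gamma_process_integrand P ?\<alpha> \<mu> g \<theta>"
    using assms by (intro gamma_process_integrand_scale)
  then interpret G: gamma_process_integrand P ?\<alpha> \<mu> g \<theta> .
  have Y: "Y \<in> measurable P borel" "distr P borel Y = H" by fact+
  have T: "distributed P lborel T (\<lambda>x. ennreal (gamma_density 1 x))" by fact
  have Tm [measurable]: "T \<in> borel_measurable P" using distributed_measurable[OF T] by simp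
  have gm [measurable]: "g \<in> borel_measurable borel" by fact
  have Xm [measurable]: "(\<lambda>w. \<integral>y. g y \<partial>\<mu> w) \<in> borel_measurable P"
    using G.measurable_X by (simp add: G.X_def[abs_def])
  have BGm: "(\<lambda>w. \<integral>y. g y \<partial>\<mu>BG w) \<in> borel_measurable Q"
    using measurable_compose[OF bg integral_measurable_bf_measures[OF gm]] .
  have Zm: "?Z U \<in> borel_measurable P" if "U \<in> borel_measurable P" for U
    using that Y(1) by measurable
  have meas: "U \<in> borel_measurable P" if "distributed P lborel U f" for U f
    using distributed_measurable[OF that] by simp
  note perturbed = char_perturbed_beta[OF gi H(2) T Y]
  have i: "distr Q borel (\<lambda>w. \<integral>y. g y \<partial>\<mu>BG w) = distr P borel (?Z U)"
    if U: "distributed P lborel U (\<lambda>x. ennreal (beta_density 1 \<theta> x))"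
      and ind: "indep_events_of P [events_of P bf_measures \<mu>, events_of P borel U, events_of P borel T, events_of P borel Y]" for U
    by (rule distr_eqI_char[OF Q G.P.prob_space_axioms BGm Zm[OF meas[OF U]]])
       (simp only: char_beta_gamma[OF gi Q bg \<open>beta_gamma_law \<theta> H (distr Q bf_measures \<mu>BG)\<close>]
          perturbed[OF zero_less_one \<theta> U ind])
  have ii: "distr P borel (\<lambda>w. V w * (\<integral>y. g y \<partial>\<mu> w)) = distr P borel (?Z U)"
    if \<theta>1: "1 < \<theta>" and V: "distributed P lborel V (\<lambda>x. ennreal (beta_density 1 (\<theta> - 1) x))"
      and indV: "indep_events_of P [events_of P bf_measures \<mu>, events_of P borel V]"
      and U: "distributed P lborel U (\<lambda>x. ennreal (beta_density 1 \<theta> x))"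
      and ind: "indep_events_of P [events_of P bf_measures \<mu>, events_of P borel U, events_of P borel T, events_of P borel Y]" for U V
  proof (rule distr_eqI_char[OF G.P.prob_space_axioms G.P.prob_space_axioms _ Zm[OF meas[OF U]]])
    show "(\<lambda>w. V w * (\<integral>y. g y \<partial>\<mu> w)) \<in> borel_measurable P" using meas[OF V] by measurable
    have "0 < \<theta> - 1" using \<theta>1 by simp
    then show "char (distr P borel (\<lambda>w. V w * (\<integral>y. g y \<partial>\<mu> w))) s = char (distr P borel (?Z U)) s" for s
      by (simp only: char_scaled_beta[OF gi zero_less_one _ V indV] perturbed[OF zero_less_one \<theta> U ind]
          G.ode.beta_identity_shape_shift[OF \<theta>1])
  qed
  have iv: "distr P borel (\<lambda>w. \<integral>y. g y \<partial>\<mu> w) = distr P borel (?Z U)"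
    if U: "distributed P lborel U (\<lambda>x. ennreal (beta_density \<theta> 1 x))"
      and ind: "indep_events_of P [events_of P bf_measures \<mu>, events_of P borel U, events_of P borel T, events_of P borel Y]" for U
  proof (rule distr_eqI_char[OF G.P.prob_space_axioms G.P.prob_space_axioms Xm Zm[OF meas[OF U]]])
    fix s
    have "char (distr P borel (\<lambda>w. \<integral>y. g y \<partial>\<mu> w)) s = G.\<Lambda> s 1"
      by (simp add: G.\<Lambda>_def G.X_def[abs_def])
    then show "char (distr P borel (\<lambda>w. \<integral>y. g y \<partial>\<mu> w)) s = char (distr P borel (?Z U)) s"
      by (simp only: perturbed[OF \<theta> zero_less_one U ind] G.ode.beta_identity_fixed_point)
  qed
  have iii: "gamma_process Q H \<mu>BG" if "\<theta> = 1"
    using that assms by (intro beta_gamma_law_1) auto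
  show ?thesis
    using i ii iii iv by blast
qed

end
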